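(* Let $(X,\sigma)$ be a classical symbolic system (a two-sided subshift $X\subset\Lambda^{\mathbb Z}$ or a one-sided subshift $X\subset\Lambda^{\mathbb N_0}$ over a finite alphabet $\Lambda$). Let $\mathcal U\supset\mathcal M^{\mathsf{erg}}_\sigma(X)$ be an open set in $\mathcal B^*(X)\cup\mathcal M(X)$ (with the metric $d^*$). For every $m\in\mathbb N$ and every $x\in X$ there exists a representation of $x$ as an infinite concatenation of finite blocks $x=\dots B_{-2}A_{-2}B_{-1}A_{-1}A_1B_1A_2B_2\dots$ (respectively $x=A_1B_1A_2B_2\dots$ in the case of a one-sided subshift), where all blocks $B_j$ are $\mathcal U$-ergodic (i.e. $B_j\in\mathcal U$) and have lengths larger than or equal to $m$ (without an upper bound on the lengths), and the set $M^{\mathsf{NE}}(x)$ of coordinates pertaining to the blocks $A_j$ in this concatenation has Banach density equal to $0$. (Some of the blocks $A_j$ may be empty.)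
   Context: $\Lambda$ is a finite discrete set. The shift is $(\sigma(x))(i)=x(i+1)$. A two-sided (one-sided) subshift is a closed subset $X$ of $\Lambda^{\mathbb Z}$ (resp. $\Lambda^{\mathbb N_0}$) invariant under $\sigma$ (i.e. $\sigma(X)=X$ in the two-sided case, $\sigma(X)\subset X$ in the one-sided case). Coordinates $i$ range over $\mathbb Z$ (resp. $\mathbb N_0$). A block of length $k$ is an element $B\in\Lambda^k$, $|B|=k$. $\mathcal B^*(X)$ is the set of all blocks occurring in elements of $X$, i.e. blocks of the form $x|_{[i,i+k)}$ with $x\in X$ (regarded as elements of $\Lambda^k$). A representation of $x$ as an infinite concatenation of blocks means that the set of all coordinates is partitioned into consecutive finite intervals and the blocks are the restrictions of $x$ to these intervals. For $B\in\Lambda^k$, $C\in\Lambda^l$ with $l\le k$, $\mathrm{Fr}_B(C)=\frac1k|\{i\in[0,k-l]: B|_{[i,i+l)}=C\}|$; if $l>k$, $\mathrm{Fr}_B(C)=0$. $\mathcal M(X)$ is the set of Borel probability measures on $X$, $\mathcal M_\sigma(X)$ the shift-invariant ones, $\mathcal M^{\mathsf{erg}}_\sigma(X)$ the ergodic ones. $[C]=\{x\in X: x|_{[0,l)}=C\}$ for $C\in\Lambda^l$. For $p\in\mathcal B^*(X)\cup\mathcal M(X)$ put $p(C)=\mathrm{Fr}_p(C)$ if $p$ is a block and $p(C)=p([C])$ if $p$ is a measure. The metric on $\mathcal B^*(X)\cup\mathcal M(X)$ is $d^*(p,q)=\sum_{l=1}^{\infty}2^{-l}\sum_{C\in\Lambda^l}|p(C)-q(C)|$.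 For a set $A$ of coordinates: upper Banach density $\overline d_{\mathsf{Ban}}(A)=\inf_{N\in\mathbb N}\sup_i\frac{|A\cap[i,i+N)|}{N}$, lower Banach density $\underline d_{\mathsf{Ban}}(A)=\sup_{N\in\mathbb N}\inf_i\frac{|A\cap[i,i+N)|}{N}$; if they coincide, the common value is called the Banach density of $A$. *)

theory Defs
  imports "HOL-Analysis.Analysis"
begin

text \<open>
  The coordinate type \<open>'i\<close> is \<^typ>\<open>int\<close> for two-sided and \<^typ>\<open>nat\<close> for one-sided sequences;
  the alphabet is a type of class \<^class>\<open>finite\<close> with the discrete topology, and \<open>'i \<Rightarrow> 'a\<close>
  carries the product topology.
\<close>

definition shift :: "('i::linordered_semidom \<Rightarrow> 'a) \<Rightarrow> ('i \<Rightarrow> 'a)" where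
  "shift x = (\<lambda>i. x (i + 1))"

definition two_sided_subshift :: "(int \<Rightarrow> 'a::{finite, discrete_topology}) set \<Rightarrow> bool" where
  "two_sided_subshift X \<longleftrightarrow> closed X \<and> shift ` X = X"

definition one_sided_subshift :: "(nat \<Rightarrow> 'a::{finite, discrete_topology}) set \<Rightarrow> bool" where
  "one_sided_subshift X \<longleftrightarrow> closed X \<and> shift ` X \<subseteq> X"

definition block :: "('i::linordered_semidom \<Rightarrow> 'a) \<Rightarrow> 'i \<Rightarrow> nat \<Rightarrow> 'a list" where
  "block x i k = map (\<lambda>j. x (i + of_nat j)) [0..<k]"

text \<open>Only blocks of positive length count, so that the frequencies below are meaningful.\<close>

definition blocks :: "('i::linordered_semidom \<Rightarrow> 'a) set \<Rightarrow> 'a list set" where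
  "blocks X = {block x i k | x i k. x \<in> X \<and> k \<ge> 1}"

definition freq :: "'a list \<Rightarrow> 'a list \<Rightarrow> real" where
  "freq B C = (if length C \<le> length B
     then real (card {i \<in> {0..length B - length C}. take (length C) (drop i B) = C})
            / real (length B)
     else 0)"

definition prob_measures ::
    "('i \<Rightarrow> 'a::{finite, discrete_topology}) set \<Rightarrow> ('i \<Rightarrow> 'a) measure set" where
  "prob_measures X =
     {\<mu>. sets \<mu> = sets (restrict_space borel X) \<and> emeasure \<mu> (space \<mu>) = 1}"

definition invariant_measures ::
    "('i::linordered_semidom \<Rightarrow> 'a::{finite, discrete_topology}) set \<Rightarrow> ('i \<Rightarrow> 'a) measure set" where
  "invariant_measures X =
     {\<mu> \<in> prob_measures X. \<forall>S\<in>sets \<mu>. emeasure \<mu> (shift -` S \<inter> X) = emeasure \<mu> S}"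

definition ergodic_measures ::
    "('i::linordered_semidom \<Rightarrow> 'a::{finite, discrete_topology}) set \<Rightarrow> ('i \<Rightarrow> 'a) measure set" where
  "ergodic_measures X =
     {\<mu> \<in> invariant_measures X.
        \<forall>S\<in>sets \<mu>. shift -` S \<inter> X = S \<longrightarrow> emeasure \<mu> S = 0 \<or> emeasure \<mu> S = 1}"

text \<open>
  The union of the blocks and the measures on \<open>X\<close> is rendered as a disjoint sum:
  \<open>Inl B\<close> is a block and \<open>Inr \<mu>\<close> a measure.
\<close>

type_synonym ('i, 'a) block_or_measure = "'a list + ('i \<Rightarrow> 'a) measure"

definition blocks_and_measures ::
    "('i::linordered_semidom \<Rightarrow> 'a::{finite, discrete_topology}) set
      \<Rightarrow> ('i, 'a) block_or_measure set" where
  "blocks_and_measures X = blocks X <+> prob_measures X"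

fun val :: "('i::linordered_semidom, 'a) block_or_measure \<Rightarrow> 'a list \<Rightarrow> real" where
  "val (Inl B) C = freq B C"
| "val (Inr \<mu>) C = measure \<mu> {x \<in> space \<mu>. block x 0 (length C) = C}"

definition dstar ::
    "('i::linordered_semidom, 'a::finite) block_or_measure \<Rightarrow> ('i, 'a) block_or_measure \<Rightarrow> real" where
  "dstar p q = (\<Sum>l. (1/2) ^ Suc l * (\<Sum>C | length C = Suc l. \<bar>val p C - val q C\<bar>))"

text \<open>
  In the two-sided case \<^const>\<open>dstar\<close> does not separate non-invariant measures that agree on all
  cylinders over nonnegative coordinates, so it is only a pseudometric there. Openness is therefore
  stated through balls directly and not through the locale \<^locale>\<open>Metric_space\<close>.
\<close>

definition dstar_open ::
    "('i::linordered_semidom \<Rightarrow> 'a::{finite, discrete_topology}) set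
      \<Rightarrow> ('i, 'a) block_or_measure set \<Rightarrow> bool" where
  "dstar_open X U \<longleftrightarrow> U \<subseteq> blocks_and_measures X \<and>
     (\<forall>p\<in>U. \<exists>e>0. \<forall>q\<in>blocks_and_measures X. dstar p q < e \<longrightarrow> q \<in> U)"

definition upper_banach_density :: "'i::linordered_semidom set \<Rightarrow> real" where
  "upper_banach_density A =
     (INF N\<in>{1::nat..}. SUP i. real (card (A \<inter> {i..<i + of_nat N})) / real N)"

definition lower_banach_density :: "'i::linordered_semidom set \<Rightarrow> real" where
  "lower_banach_density A =
     (SUP N\<in>{1::nat..}. INF i. real (card (A \<inter> {i..<i + of_nat N})) / real N)"

definition has_banach_density :: "'i::linordered_semidom set \<Rightarrow> real \<Rightarrow> bool" where
  "has_banach_density A d \<longleftrightarrow> upper_banach_density A = d \<and> lower_banach_density A = d"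

text \<open>
  A partition of all coordinates into consecutive finite (possibly empty) intervals, the cells: the
  \<open>n\<close>-th cell starts at \<open>s n\<close> and has length \<open>len n\<close>. The index \<open>n\<close> ranges over the same type as
  the coordinates.
\<close>

definition cell :: "('i::linordered_semidom \<Rightarrow> 'i) \<Rightarrow> ('i \<Rightarrow> nat) \<Rightarrow> 'i \<Rightarrow> 'i set" where
  "cell s len n = {s n..<s n + of_nat (len n)}"

definition consecutive_partition :: "('i::linordered_semidom \<Rightarrow> 'i) \<Rightarrow> ('i \<Rightarrow> nat) \<Rightarrow> bool" where
  "consecutive_partition s len \<longleftrightarrow>
     (\<forall>n. s (n + 1) = s n + of_nat (len n)) \<and> (\<Union>n. cell s len n) = UNIV"

text \<open>
  The pattern of the concatenation. Over \<^typ>\<open>int\<close> the cells are labelled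
    \<open>\<dots> B\<^sub>-\<^sub>2 A\<^sub>-\<^sub>2 B\<^sub>-\<^sub>1 A\<^sub>-\<^sub>1 A\<^sub>1 B\<^sub>1 A\<^sub>2 B\<^sub>2 \<dots>\<close>,
  where \<open>A\<^sub>1\<close> is cell \<open>0\<close> and \<open>A\<^sub>-\<^sub>1\<close> is cell \<open>-1\<close>; for \<open>j \<ge> 1\<close>, the blocks \<open>A\<^sub>j\<close>, \<open>B\<^sub>j\<close> are
  cells \<open>2j - 2\<close>, \<open>2j - 1\<close>, and \<open>A\<^sub>-\<^sub>j\<close>, \<open>B\<^sub>-\<^sub>j\<close> are cells \<open>-2j + 1\<close>, \<open>-2j\<close>. Over \<^typ>\<open>nat\<close> only
  \<open>A\<^sub>1 B\<^sub>1 A\<^sub>2 B\<^sub>2 \<dots>\<close> remains.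
\<close>

definition A_cells :: "'i::{linordered_semidom, semiring_parity} set" where
  "A_cells = {n. if n \<ge> 0 then even n else odd n}"

definition B_cells :: "'i::{linordered_semidom, semiring_parity} set" where
  "B_cells = - A_cells"

end

theory Submission
  imports Defs
begin

text \<open>
  In the one-sided case the blocks are chosen greedily from coordinate \<open>0\<close>: wherever some block of
  length at least \<open>m\<close> starting there lies in \<open>U\<close> it is cut off, and all other coordinates visited go
  to the blocks \<open>A\<^sub>j\<close>. In the two-sided case the same is done from \<open>0\<close> to the right and, with blocks
  ending at a coordinate, from \<open>0\<close> to the left. It remains to see that the coordinates at which no
  block of \<open>U\<close> of length at least \<open>m\<close> starts (or ends) have Banach density \<open>0\<close>.

  Shift-invariant measures are represented by their values \<open>p(C)\<close> on cylinders. If the bad coordinates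
  had positive upper Banach density, a limit of frequencies along long intervals rich in them would be
  an invariant weight giving mass at least \<open>\<delta> > 0\<close>, for every \<open>n\<close>, to the words of length \<open>n\<close>
  none of whose prefixes (or suffixes) of length at least \<open>m\<close> lies in \<open>U\<close>. Maximising this mass and
  then a strictly convex function yields an extreme such weight. Extremality forces the frequencies
  of long words to concentrate, in place of the ergodic theorem, and makes the measure extending the
  weight ergodic. Hence some long word without a prefix in \<open>U\<close> is so close to this ergodic measure
  that it lies in \<open>U\<close> itself, a contradiction.
\<close>

section \<open>Words and frequencies\<close>

text \<open>A limit of frequencies along intervals rich in bad coordinates is invariant but need not
  be ergodic, while \<open>U\<close> is only known to contain neighbourhoods of the ergodic
  measures. So an ergodic measure is needed that still charges the bad words of every length. An
  ergodic decomposition would supply one; here it comes from convexity. The bad words are closed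
  under prefixes (or suffixes), so their mass decreases with the length. Its limit is therefore
  affine in the weight, unlike a general infimum, and the weights maximising it form a face of the
  set of normalised invariant weights. A maximiser of a strictly convex function on this face is
  extreme in the face, hence extreme in the whole set.

  Only one word is wanted in the end, which is why concentration in measure suffices and no
  pointwise convergence is used: once the words of length \<open>n\<close> with atypical frequencies
  weigh less than \<delta>, they cannot exhaust the bad words.\<close>

definition words :: "nat \<Rightarrow> 'a list set" where
  "words n = {B. length B = n}"

definition occurrences :: "'a list \<Rightarrow> 'a list \<Rightarrow> nat set" where
  "occurrences B C = {i. i + length C \<le> length B \<and> take (length C) (drop i B) = C}"

lemma finite_words [simp]: "finite (words n :: 'a::finite list set)"
  using finite_lists_length_eq[of "UNIV :: 'a set" n] by (simp add: words_def)

lemma words_0 [simp]: "words 0 = {[]}"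
  by (auto simp: words_def)

lemma finite_occurrences [simp]: "finite (occurrences B C)"
  by (rule finite_subset[of _ "{..length B}"]) (auto simp: occurrences_def)

lemma freq_eq: "freq B C = real (card (occurrences B C)) / real (length B)"
proof (cases "length C \<le> length B")
  case True
  then have "{i \<in> {0..length B - length C}. take (length C) (drop i B) = C} = occurrences B C"
    by (auto simp: occurrences_def)
  with True show ?thesis by (simp add: freq_def)
next
  case False
  then have "occurrences B C = {}" by (auto simp: occurrences_def)
  with False show ?thesis by (simp add: freq_def)
qed

lemma freq_nonneg [simp]: "0 \<le> freq B C"
  by (simp add: freq_eq)

lemma occurrences_Nil: "occurrences B [] = {..length B}"
  by (auto simp: occurrences_def)

text \<open>The bound is 2 and not 1 because of the empty word, which occurs at
  \<open>length B + 1\<close> positions.\<close>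

lemma freq_le_2: "freq B C \<le> 2"
proof (cases "B = []")
  case False
  have "card (occurrences B C) \<le> card {..length B}"
    by (intro card_mono) (auto simp: occurrences_def)
  then have "card (occurrences B C) \<le> 2 * length B"
    using False by (cases B) auto
  then show ?thesis using False by (simp add: freq_eq field_simps flip: of_nat_mult)
qed (simp add: freq_eq)

lemma freq_pos_factor:
  assumes "freq B C > 0"
  obtains U V where "B = U @ C @ V"
proof -
  from assms have "occurrences B C \<noteq> {}" by (auto simp: freq_eq)
  then obtain i where i: "take (length C) (drop i B) = C" by (auto simp: occurrences_def)
  have "B = take i B @ C @ drop (length C) (drop i B)"
    by (metis i append_take_drop_id)
  then show ?thesis by (rule that)
qed

lemma sum_card_fibres:
  fixes g :: "'b \<Rightarrow> 'a::finite"
  assumes "finite S"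
  shows "(\<Sum>a\<in>UNIV. card {i\<in>S. g i = a}) = card S"
proof -
  have "(\<Sum>a\<in>UNIV. card {i\<in>S. g i = a}) = (\<Sum>a\<in>UNIV. \<Sum>i\<in>{i\<in>S. g i = a}. 1)" by simp
  also have "\<dots> = (\<Sum>i\<in>S. 1)" by (rule sum.group) (use assms in auto)
  finally show ?thesis by simp
qed

lemma occurrences_snoc:
  "occurrences B (C @ [a]) = {i\<in>occurrences B C. i + length C < length B \<and> B ! (i + length C) = a}"
  by (auto simp: occurrences_def take_Suc_conv_app_nth)

text \<open>Each occurrence of \<open>C\<close> extends to exactly one \<open>C @ [a]\<close>,
  except an occurrence at the very end of \<open>B\<close>; there is at most one of these.\<close>

lemma sum_freq_snoc:
  fixes B C :: "'a::finite list"
  assumes "B \<noteq> []"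
  shows "\<bar>freq B C - (\<Sum>a\<in>UNIV. freq B (C @ [a]))\<bar> \<le> 1 / length B"
proof -
  let ?S = "{i\<in>occurrences B C. i + length C < length B}"
  have "(\<Sum>a\<in>UNIV. card (occurrences B (C @ [a]))) = (\<Sum>a\<in>UNIV. card {i\<in>?S. B ! (i + length C) = a})"
    by (simp add: occurrences_snoc conj_assoc)
  also have "\<dots> = card ?S" by (rule sum_card_fibres) simp
  finally have 1: "(\<Sum>a\<in>UNIV. freq B (C @ [a])) = card ?S / length B"
    by (simp add: freq_eq flip: sum_divide_distrib of_nat_sum)
  have "occurrences B C \<subseteq> insert (length B - length C) ?S" by (auto simp: occurrences_def)
  then have "card (occurrences B C) \<le> card (insert (length B - length C) ?S)" by (intro card_mono) auto
  also have "\<dots> \<le> card ?S + 1" by (simp add: card_insert_if)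
  finally have 2: "card (occurrences B C) \<le> card ?S + 1" .
  have 3: "card ?S \<le> card (occurrences B C)" by (intro card_mono) auto
  have "\<bar>real (card (occurrences B C)) - real (card ?S)\<bar> \<le> 1" using 2 3 by linarith
  then show ?thesis unfolding 1 unfolding freq_eq diff_divide_distrib[symmetric] abs_divide
    by (simp add: divide_right_mono)
qed

lemma occurrences_Cons:
  "occurrences B (a # C) = {i. Suc i \<in> occurrences B C \<and> B ! i = a}"
proof -
  have "take (Suc (length C)) (drop i B) = a # C \<longleftrightarrow> take (length C) (drop (Suc i) B) = C \<and> B ! i = a"
    if "i < length B" for i
    using that by (auto simp: Cons_nth_drop_Suc[symmetric])
  then show ?thesis by (auto simp: occurrences_def)
qed

text \<open>Mirror image of \<open>sum_freq_snoc\<close>: only an occurrence at position 0 has no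
  letter before it.\<close>

lemma sum_freq_Cons:
  fixes B C :: "'a::finite list"
  assumes "B \<noteq> []"
  shows "\<bar>freq B C - (\<Sum>a\<in>UNIV. freq B (a # C))\<bar> \<le> 1 / length B"
proof -
  let ?S = "{i. Suc i \<in> occurrences B C}"
  have fin: "finite ?S" by (rule finite_subset[of _ "{..length B}"]) (auto simp: occurrences_def)
  have "(\<Sum>a\<in>UNIV. card (occurrences B (a # C))) = (\<Sum>a\<in>UNIV. card {i\<in>?S. B ! i = a})"
    by (simp add: occurrences_Cons)
  also have "\<dots> = card ?S" by (rule sum_card_fibres) (rule fin)
  finally have 1: "(\<Sum>a\<in>UNIV. freq B (a # C)) = card ?S / length B"
    by (simp add: freq_eq flip: sum_divide_distrib of_nat_sum)
  have "occurrences B C \<subseteq> insert 0 (Suc ` ?S)"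
    by (auto simp: image_iff) (metis not0_implies_Suc)
  then have "card (occurrences B C) \<le> card (insert 0 (Suc ` ?S))" by (intro card_mono) (use fin in auto)
  also have "\<dots> \<le> card ?S + 1" using fin by (simp add: card_insert_if card_image)
  finally have 2: "card (occurrences B C) \<le> card ?S + 1" .
  have "card (Suc ` ?S) \<le> card (occurrences B C)" by (intro card_mono) auto
  then have 3: "card ?S \<le> card (occurrences B C)" by (simp add: card_image)
  have "\<bar>real (card (occurrences B C)) - real (card ?S)\<bar> \<le> 1" using 2 3 by linarith
  then show ?thesis unfolding 1 unfolding freq_eq diff_divide_distrib[symmetric] abs_divide
    by (simp add: divide_right_mono)
qed

lemma sum_words_Suc:
  fixes f :: "'a::finite list \<Rightarrow> 'b::comm_monoid_add"
  shows "(\<Sum>B\<in>words (Suc n). f B) = (\<Sum>a\<in>UNIV. \<Sum>B\<in>words n. f (a # B))"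
proof -
  have "bij_betw (\<lambda>(a, B). a # B) (UNIV \<times> words n) (words (Suc n))"
    by (rule bij_betw_byWitness[where f' = "\<lambda>B. (hd B, tl B)"]) (auto simp: words_def length_Suc_conv)
  then have "(\<Sum>B\<in>words (Suc n). f B) = (\<Sum>(a, B)\<in>UNIV \<times> words n. f (a # B))"
    by (subst sum.reindex_bij_betw[symmetric]) (auto simp: case_prod_unfold)
  then show ?thesis by (simp add: sum.cartesian_product)
qed

lemma sum_words_add:
  fixes f :: "'a::finite list \<Rightarrow> 'b::comm_monoid_add"
  shows "(\<Sum>B\<in>words (m + n). f B) = (\<Sum>U\<in>words m. \<Sum>V\<in>words n. f (U @ V))"
  by (induction m arbitrary: f) (simp_all add: sum_words_Suc)

lemma sum_freq_words:
  fixes B :: "'a::finite list" and H :: "'a list set"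
  shows "(\<Sum>C\<in>H \<inter> words n. freq B C) = card {i. i + n \<le> length B \<and> take n (drop i B) \<in> H} / length B"
proof -
  let ?S = "{i. i + n \<le> length B \<and> take n (drop i B) \<in> H}"
  have fin: "finite ?S" by (rule finite_subset[of _ "{..length B}"]) auto
  have "occurrences B C = {i\<in>?S. take n (drop i B) = C}" if "C \<in> H \<inter> words n" for C
    using that by (auto simp: occurrences_def words_def)
  then have "(\<Sum>C\<in>H \<inter> words n. card (occurrences B C)) = (\<Sum>C\<in>H \<inter> words n. \<Sum>i\<in>{i\<in>?S. take n (drop i B) = C}. 1)"
    by (intro sum.cong refl) simp
  also have "\<dots> = (\<Sum>i\<in>?S. 1)"
    by (rule sum.group[OF fin]) (auto simp: words_def finite_words[unfolded words_def])
  finally show ?thesis by (simp add: freq_eq flip: sum_divide_distrib of_nat_sum)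
qed

lemma sum_freq_le_1:
  fixes B :: "'a::finite list"
  assumes "n \<ge> 1"
  shows "(\<Sum>C\<in>words n. freq B C) \<le> 1"
proof -
  have "{i. i + n \<le> length B} \<subseteq> {..<length B}" using assms by auto
  then have "card {i. i + n \<le> length B} \<le> card {..<length B}" by (intro card_mono) auto
  then show ?thesis
    using sum_freq_words[where H = UNIV and n = n and B = B] by (simp add: divide_le_eq_1)
qed

section \<open>Invariant weights\<close>

text \<open>The sum over \<open>C @ [a]\<close> is Kolmogorov consistency, the sum over
  \<open>a # C\<close> is shift invariance. The total mass \<open>q []\<close> is left free, so that
  summands and limits of weights are covered.\<close>

definition invariant_weight :: "'a::finite list set \<Rightarrow> ('a list \<Rightarrow> real) \<Rightarrow> bool" where
  "invariant_weight L q \<longleftrightarrow>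
     (\<forall>C. 0 \<le> q C) \<and> (\<forall>C. (\<Sum>a\<in>UNIV. q (C @ [a])) = q C) \<and>
     (\<forall>C. (\<Sum>a\<in>UNIV. q (a # C)) = q C) \<and> (\<forall>C. C \<notin> L \<longrightarrow> q C = 0)"

text \<open>
  Extremality among the normalised weights, stated homogeneously so that no division is needed:
  every invariant summand of \<open>p\<close> is a multiple of \<open>p\<close>.
\<close>

definition extreme_weight :: "'a::finite list set \<Rightarrow> ('a list \<Rightarrow> real) \<Rightarrow> bool" where
  "extreme_weight L p \<longleftrightarrow> invariant_weight L p \<and> p [] = 1 \<and>
     (\<forall>q r. invariant_weight L q \<and> invariant_weight L r \<and> (\<forall>C. p C = q C + r C) \<longrightarrow>
        (\<forall>C. q C = q [] * p C))"

definition factor_closed :: "'a list set \<Rightarrow> bool" where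
  "factor_closed L \<longleftrightarrow> (\<forall>U C V. U @ C @ V \<in> L \<longrightarrow> C \<in> L)"

lemma invariant_weightD:
  assumes "invariant_weight L q"
  shows "0 \<le> q C" "(\<Sum>a\<in>UNIV. q (C @ [a])) = q C" "(\<Sum>a\<in>UNIV. q (a # C)) = q C"
    "C \<notin> L \<Longrightarrow> q C = 0"
  using assms by (auto simp: invariant_weight_def)

lemma invariant_weight_append:
  assumes "invariant_weight L q"
  shows "(\<Sum>V\<in>words n. q (C @ V)) = q C"
proof (induction n arbitrary: C)
  case (Suc n)
  have "(\<Sum>V\<in>words (Suc n). q (C @ V)) = (\<Sum>a\<in>UNIV. \<Sum>V\<in>words n. q ((C @ [a]) @ V))"
    by (simp add: sum_words_Suc)
  also have "\<dots> = q C" unfolding Suc.IH by (rule invariant_weightD(2)[OF assms])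
  finally show ?case .
qed simp

lemma invariant_weight_prepend:
  assumes "invariant_weight L q"
  shows "(\<Sum>U\<in>words n. q (U @ C)) = q C"
proof (induction n)
  case (Suc n)
  have "(\<Sum>U\<in>words (Suc n). q (U @ C)) = (\<Sum>a\<in>UNIV. \<Sum>U\<in>words n. q (a # U @ C))"
    by (simp add: sum_words_Suc)
  also have "\<dots> = (\<Sum>U\<in>words n. q (U @ C))"
    by (subst sum.swap) (simp add: invariant_weightD(3)[OF assms])
  finally show ?case by (simp add: Suc.IH)
qed simp

lemma invariant_weight_total:
  assumes "invariant_weight L q"
  shows "(\<Sum>U\<in>words n. q U) = q []"
  using invariant_weight_append[OF assms, of "[]" n] by simp

lemma invariant_weight_le:
  assumes "invariant_weight L q"
  shows "q C \<le> q []"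
proof -
  have "q C \<le> (\<Sum>U\<in>words (length C). q U)"
    by (rule member_le_sum) (auto simp: words_def invariant_weightD(1)[OF assms] finite_words[unfolded words_def])
  then show ?thesis by (simp add: invariant_weight_total[OF assms])
qed

text \<open>A word of length \<open>n\<close> splits as \<open>U @ C @ V\<close> around the window;
  \<open>V\<close> is summed out by consistency and \<open>U\<close> by invariance. Hence the
  position \<open>i\<close> of the window does not matter.\<close>

lemma invariant_weight_window:
  assumes q: "invariant_weight L q" and Q: "Q \<subseteq> words l" and le: "i + l \<le> n"
  shows "(\<Sum>B\<in>{B\<in>words n. take l (drop i B) \<in> Q}. q B) = (\<Sum>C\<in>Q. q C)"
proof -
  obtain j where n: "n = i + (l + j)" using le by (metis add.assoc le_iff_add)
  have eq: "(\<Sum>V\<in>words j. if take l (drop i (U @ C @ V)) \<in> Q then q (U @ C @ V) else 0)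
      = (if C \<in> Q then \<Sum>V\<in>words j. q (U @ C @ V) else 0)"
    if "U \<in> words i" "C \<in> words l" for U C
  proof -
    have *: "take l (drop i (U @ C @ V)) = C" for V using that by (auto simp: words_def)
    show ?thesis by (cases "C \<in> Q") (simp_all only: * if_True if_False sum.neutral_const)
  qed
  have finQ: "finite Q" using Q finite_subset finite_words by blast
  have "(\<Sum>B\<in>{B\<in>words n. take l (drop i B) \<in> Q}. q B)
      = (\<Sum>B\<in>words n. if take l (drop i B) \<in> Q then q B else 0)"
    by (simp add: sum.If_cases Int_def)
  also have "\<dots> = (\<Sum>U\<in>words i. \<Sum>C\<in>words l. if C \<in> Q then \<Sum>V\<in>words j. q (U @ C @ V) else 0)"
    unfolding n sum_words_add by (intro sum.cong refl eq)
  also have "\<dots> = (\<Sum>C\<in>words l. if C \<in> Q then \<Sum>U\<in>words i. \<Sum>V\<in>words j. q (U @ C @ V) else 0)"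
    by (subst sum.swap) (auto intro!: sum.cong)
  also have "\<dots> = (\<Sum>C\<in>words l. if C \<in> Q then q C else 0)"
  proof -
    have "(\<Sum>V\<in>words j. q (U @ C @ V)) = q (U @ C)" for U C
      using invariant_weight_append[OF q, of "U @ C" j] by simp
    then show ?thesis by (simp add: invariant_weight_prepend[OF q] cong: if_cong)
  qed
  also have "\<dots> = (\<Sum>C\<in>Q. q C)"
    using Q by (simp add: sum.If_cases Int_absorb1)
  finally show ?thesis .
qed

text \<open>After exchanging the sums, each position where \<open>C\<close> fits contributes
  \<open>q C\<close> by \<open>invariant_weight_window\<close>.\<close>

lemma invariant_weight_mean_freq:
  assumes q: "invariant_weight L q"
  shows "(\<Sum>B\<in>words n. q B * freq B C) = card {i. i + length C \<le> n} / n * q C"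
proof -
  let ?I = "{i. i + length C \<le> n}"
  have finI: "finite ?I" by (rule finite_subset[of _ "{..n}"]) auto
  have *: "(\<Sum>B\<in>words n. if i \<in> occurrences B C then q B else 0) = q C" if "i \<in> ?I" for i
  proof -
    have "(\<Sum>B\<in>words n. if i \<in> occurrences B C then q B else 0)
       = (\<Sum>B\<in>{B\<in>words n. i \<in> occurrences B C}. q B)"
      by (rule sum.inter_filter[symmetric]) simp
    also have "{B\<in>words n. i \<in> occurrences B C} = {B\<in>words n. take (length C) (drop i B) \<in> {C}}"
      using that by (auto simp: occurrences_def words_def)
    also have "(\<Sum>B\<in>\<dots>. q B) = (\<Sum>D\<in>{C}. q D)"
      by (rule invariant_weight_window[OF q]) (use that in \<open>auto simp: words_def\<close>)
    finally show ?thesis by simp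
  qed
  have "q B * freq B C = (\<Sum>i\<in>?I. if i \<in> occurrences B C then q B else 0) / n" if "B \<in> words n" for B
  proof -
    have "?I \<inter> {i. i \<in> occurrences B C} = occurrences B C" using that by (auto simp: occurrences_def words_def)
    then show ?thesis using that finI by (simp add: sum.If_cases freq_eq words_def)
  qed
  then have "(\<Sum>B\<in>words n. q B * freq B C)
     = (\<Sum>B\<in>words n. \<Sum>i\<in>?I. if i \<in> occurrences B C then q B else 0) / n"
    by (simp add: sum_divide_distrib cong: sum.cong)
  also have "\<dots> = (\<Sum>i\<in>?I. \<Sum>B\<in>words n. if i \<in> occurrences B C then q B else 0) / n"
    by (subst sum.swap) simp
  also have "(\<Sum>i\<in>?I. \<Sum>B\<in>words n. if i \<in> occurrences B C then q B else 0) = (\<Sum>i\<in>?I. q C)"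
    by (intro sum.cong refl *)
  finally show ?thesis by simp
qed

lemma mean_freq_factor_tendsto:
  "(\<lambda>n. real (card {i. i + l \<le> n}) / real n) \<longlonglongrightarrow> 1"
proof -
  have "eventually (\<lambda>n. 1 - (real l) / n + 1 / n = real (card {i. i + l \<le> n}) / real n) sequentially"
    using eventually_ge_at_top[of "Suc l"]
  proof eventually_elim
    case (elim n)
    have "{i. i + l \<le> n} = {..n - l}" using elim by auto
    then show ?case using elim by (simp add: field_simps of_nat_diff)
  qed
  moreover have "(\<lambda>n. 1 - (real l) / n + 1 / n) \<longlonglongrightarrow> 1 - 0 + 0"
    by (intro tendsto_intros lim_const_over_n)
  ultimately show ?thesis using Lim_transform_eventually by fastforce
qed

section \<open>Limits of empirical weights\<close>

text \<open>Tychonoff's theorem; the index type is countable, so the product is metrizable and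
  compactness yields subsequences.\<close>

lemma pointwise_subsequence:
  fixes f :: "nat \<Rightarrow> 'b::countable \<Rightarrow> real"
  assumes "\<And>k C. f k C \<in> {0..M}"
  obtains r q where "strict_mono r" "\<And>C. (\<lambda>k. f (r k) C) \<longlonglongrightarrow> q C"
proof -
  have "compactin (product_topology (\<lambda>_::'b. euclidean) UNIV) (PiE UNIV (\<lambda>_. {0..M}))"
    by (subst compactin_PiE) auto
  then have "compact (PiE UNIV (\<lambda>_::'b. {0..M}))"
    by (simp add: euclidean_product_topology)
  then have "seq_compact (PiE UNIV (\<lambda>_::'b. {0..M}))"
    by (simp add: compact_eq_seq_compact_metric)
  then obtain q r where r: "strict_mono r" "(f \<circ> r) \<longlonglongrightarrow> q"
    using assms by (metis PiE_UNIV_domain Pi_I UNIV_I seq_compactE)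
  have "(\<lambda>k. f (r k) C) \<longlonglongrightarrow> q C" for C
    using continuous_on_tendsto_compose[OF continuous_on_product_coordinates[of C] r(2)]
    by (simp add: o_def)
  with r(1) show ?thesis by (rule that)
qed

text \<open>The frequencies in a word of length \<open>k\<close> violate the two sum conditions by
  at most \<open>1 / k\<close>, and averaging with total weight at most 1 keeps this bound. The
  averaging weights are arbitrary because two kinds are used: point masses at single words, and
  parts of an extreme weight.\<close>

lemma invariant_weight_limit:
  fixes wt :: "nat \<Rightarrow> 'a::finite list \<Rightarrow> real" and L :: "'a list set"
  assumes fac: "factor_closed L"
    and wt: "\<And>k B. 0 \<le> wt k B" "\<And>k. (\<Sum>B\<in>words k. wt k B) \<le> 1" "\<And>k B. B \<notin> L \<Longrightarrow> wt k B = 0"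
    and r: "strict_mono r"
    and lim: "\<And>C. (\<lambda>k. \<Sum>B\<in>words (r k). wt (r k) B * freq B C) \<longlonglongrightarrow> q C"
  shows "invariant_weight L q"
proof -
  define c where "c k C = (\<Sum>B\<in>words k. wt k B * freq B C)" for k C
  have lim: "(\<lambda>k. c (r k) C) \<longlonglongrightarrow> q C" for C using lim by (simp add: c_def)
  have close: "(\<Sum>a\<in>UNIV. q (D a)) = q C"
    \<comment> \<open>\<open>D a\<close> stands for \<open>C @ [a]\<close> or for
      \<open>a # C\<close>, so that both sum conditions are treated at once.\<close>
    if D: "\<And>B. B \<noteq> [] \<Longrightarrow> \<bar>freq B C - (\<Sum>a\<in>UNIV. freq B (D a))\<bar> \<le> 1 / length B"
    for C and D :: "'a \<Rightarrow> 'a list"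
  proof -
    have "\<bar>c k C - (\<Sum>a\<in>UNIV. c k (D a))\<bar> \<le> 1 / k" if "k \<ge> 1" for k
    proof -
      have "c k C - (\<Sum>a\<in>UNIV. c k (D a)) = (\<Sum>B\<in>words k. wt k B * (freq B C - (\<Sum>a\<in>UNIV. freq B (D a))))"
        unfolding c_def by (subst sum.swap) (simp add: sum_subtractf right_diff_distrib sum_distrib_left)
      also have "\<bar>\<dots>\<bar> \<le> (\<Sum>B\<in>words k. \<bar>wt k B * (freq B C - (\<Sum>a\<in>UNIV. freq B (D a)))\<bar>)"
        by (rule sum_abs)
      also have "\<dots> \<le> (\<Sum>B\<in>words k. wt k B * (1 / k))"
      proof (rule sum_mono)
        fix B :: "'a list" assume "B \<in> words k"
        then have "length B = k" "B \<noteq> []" using that by (auto simp: words_def)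
        then have "\<bar>freq B C - (\<Sum>a\<in>UNIV. freq B (D a))\<bar> \<le> 1 / k" using D by metis
        then show "\<bar>wt k B * (freq B C - (\<Sum>a\<in>UNIV. freq B (D a)))\<bar> \<le> wt k B * (1 / k)"
          unfolding abs_mult using wt(1)[of k B] by (simp add: mult_left_mono del: times_divide_eq_right)
      qed
      also have "\<dots> \<le> 1 / k" using wt(2)[of k] by (simp add: divide_right_mono flip: sum_divide_distrib)
      finally show ?thesis .
    qed
    then have "eventually (\<lambda>k. norm (c k C - (\<Sum>a\<in>UNIV. c k (D a))) \<le> 1 / k) sequentially"
      by (intro eventually_sequentiallyI[of 1]) auto
    then have "(\<lambda>k. c k C - (\<Sum>a\<in>UNIV. c k (D a))) \<longlonglongrightarrow> 0"
      by (rule Lim_null_comparison) (rule lim_const_over_n)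
    then have zero: "(\<lambda>k. c (r k) C - (\<Sum>a\<in>UNIV. c (r k) (D a))) \<longlonglongrightarrow> 0"
      using LIMSEQ_subseq_LIMSEQ[OF _ r] by (fastforce simp: o_def)
    have "(\<lambda>k. c (r k) C - (\<Sum>a\<in>UNIV. c (r k) (D a))) \<longlonglongrightarrow> q C - (\<Sum>a\<in>UNIV. q (D a))"
      by (intro tendsto_intros lim)
    from LIMSEQ_unique[OF this zero] show ?thesis by simp
  qed
  have pos: "0 \<le> q C" for C
    by (rule LIMSEQ_le_const[OF lim]) (auto simp: c_def intro!: sum_nonneg mult_nonneg_nonneg wt)
  have supp: "q C = 0" if "C \<notin> L" for C
  proof -
    have "wt k B * freq B C = 0" for k B
    proof (rule ccontr)
      assume "wt k B * freq B C \<noteq> 0"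
      then have "B \<in> L" and "freq B C \<noteq> 0" using wt(3) by auto
      moreover from this(2) have "freq B C > 0" using freq_nonneg[of B C] by linarith
      then obtain U V where "B = U @ C @ V" by (rule freq_pos_factor)
      ultimately show False using fac that by (auto simp: factor_closed_def)
    qed
    then have "c k C = 0" for k unfolding c_def by (simp add: sum.neutral)
    with lim[of C] show ?thesis by (simp add: LIMSEQ_const_iff)
  qed
  show ?thesis unfolding invariant_weight_def
    using pos supp close[OF sum_freq_snoc] close[OF sum_freq_Cons] by blast
qed

section \<open>Extreme invariant weights\<close>

text \<open>The first alternative serves the coordinates where no good block starts, the second
  those where none ends.\<close>

definition hereditary :: "'a list set \<Rightarrow> bool" where
  "hereditary H \<longleftrightarrow> (\<forall>B\<in>H. \<forall>U V. B = U @ V \<longrightarrow> U \<in> H) \<or> (\<forall>B\<in>H. \<forall>U V. B = U @ V \<longrightarrow> V \<in> H)"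

definition mass :: "'a list set \<Rightarrow> ('a list \<Rightarrow> real) \<Rightarrow> nat \<Rightarrow> real" where
  "mass H q n = (\<Sum>B\<in>H \<inter> words n. q B)"

lemma mass_if: "mass H q n = (\<Sum>B\<in>words n. if B \<in> H then q B else 0)"
  for q :: "'a::finite list \<Rightarrow> real"
  by (simp add: mass_def sum.If_cases Int_commute Collect_mem_eq)

text \<open>Membership of a word in \<open>H\<close> passes to the word without its last (or first)
  letter, and that letter is then summed out.\<close>

lemma mass_Suc_le:
  assumes q: "invariant_weight L q" and H: "hereditary H"
  shows "mass H q (Suc n) \<le> mass H q n"
  using H unfolding hereditary_def
proof
  assume H: "\<forall>B\<in>H. \<forall>U V. B = U @ V \<longrightarrow> U \<in> H"
  have "mass H q (n + 1) \<le> (\<Sum>U\<in>words n. \<Sum>V\<in>words 1. if U \<in> H then q (U @ V) else 0)"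
    unfolding mass_if sum_words_add
    by (intro sum_mono) (use H invariant_weightD(1)[OF q] in auto)
  also have "\<dots> = mass H q n"
    unfolding mass_if by (intro sum.cong refl) (simp add: invariant_weight_append[OF q])
  finally show ?thesis by simp
next
  assume H: "\<forall>B\<in>H. \<forall>U V. B = U @ V \<longrightarrow> V \<in> H"
  have "mass H q (1 + n) \<le> (\<Sum>U\<in>words 1. \<Sum>V\<in>words n. if V \<in> H then q (U @ V) else 0)"
    unfolding mass_if sum_words_add
    by (intro sum_mono) (use H invariant_weightD(1)[OF q] in auto)
  also have "\<dots> = mass H q n"
    unfolding mass_if by (subst sum.swap, intro sum.cong refl) (simp add: invariant_weight_prepend[OF q])
  finally show ?thesis by simp
qed

lemma mass_le_total:
  assumes q: "invariant_weight L q"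
  shows "mass H q n \<le> q []"
proof -
  have "mass H q n \<le> (\<Sum>B\<in>words n. q B)"
    unfolding mass_if by (intro sum_mono) (use invariant_weightD(1)[OF q] in auto)
  then show ?thesis by (simp add: invariant_weight_total[OF q])
qed

lemma mass_nonneg: "invariant_weight L q \<Longrightarrow> 0 \<le> mass H q n"
  unfolding mass_def by (intro sum_nonneg invariant_weightD(1))

section \<open>Compactness of the set of normalised invariant weights\<close>

lemma invariant_weight_scale:
  "invariant_weight L q \<Longrightarrow> 0 \<le> c \<Longrightarrow> invariant_weight L (\<lambda>C. c * q C)"
  by (simp add: invariant_weight_def flip: sum_distrib_left)

lemma invariant_weight_pointwise_limit:
  assumes inv: "\<And>k. invariant_weight L (f k)" and lim: "\<And>C. (\<lambda>k. f k C) \<longlonglongrightarrow> q C"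
  shows "invariant_weight L q"
proof -
  have "0 \<le> q C" for C
    by (rule LIMSEQ_le_const[OF lim]) (auto intro: invariant_weightD(1)[OF inv])
  moreover have "(\<Sum>a\<in>UNIV. q (C @ [a])) = q C" for C
  proof (rule LIMSEQ_unique)
    show "(\<lambda>k. \<Sum>a\<in>UNIV. f k (C @ [a])) \<longlonglongrightarrow> (\<Sum>a\<in>UNIV. q (C @ [a]))"
      by (intro tendsto_intros lim)
    show "(\<lambda>k. \<Sum>a\<in>UNIV. f k (C @ [a])) \<longlonglongrightarrow> q C"
      unfolding invariant_weightD(2)[OF inv] by (rule lim)
  qed
  moreover have "(\<Sum>a\<in>UNIV. q (a # C)) = q C" for C
  proof (rule LIMSEQ_unique)
    show "(\<lambda>k. \<Sum>a\<in>UNIV. f k (a # C)) \<longlonglongrightarrow> (\<Sum>a\<in>UNIV. q (a # C))"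
      by (intro tendsto_intros lim)
    show "(\<lambda>k. \<Sum>a\<in>UNIV. f k (a # C)) \<longlonglongrightarrow> q C"
      unfolding invariant_weightD(3)[OF inv] by (rule lim)
  qed
  moreover have "q C = 0" if "C \<notin> L" for C
    using lim[of C] by (simp add: invariant_weightD(4)[OF inv that] LIMSEQ_const_iff)
  ultimately show ?thesis by (simp add: invariant_weight_def)
qed

lemma invariant_weight_compact:
  assumes inv: "\<And>k. invariant_weight L (f k)" "\<And>k. f k [] = 1"
  obtains r p where "strict_mono (r :: nat \<Rightarrow> nat)" "\<And>C. (\<lambda>k. f (r k) C) \<longlonglongrightarrow> p C"
    "invariant_weight L p" "p [] = 1"
proof -
  have "f k C \<in> {0..1}" for k C
    using invariant_weightD(1)[OF inv(1), of k C] invariant_weight_le[OF inv(1), of k C] inv(2)[of k] by simp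
  then obtain r p where rp: "strict_mono r" "\<And>C. (\<lambda>k. f (r k) C) \<longlonglongrightarrow> p C"
    by (rule pointwise_subsequence[of f 1]) blast
  have "p [] = 1" using rp(2)[of "[]"] by (simp add: inv(2) LIMSEQ_const_iff)
  with rp show ?thesis
    using that invariant_weight_pointwise_limit[of L "\<lambda>k. f (r k)" p] inv(1) by blast
qed

text \<open>Strictly convex on the unit cube, so its maximisers over a face of the invariant weights are extreme.\<close>

definition energy :: "('a::countable list \<Rightarrow> real) \<Rightarrow> real" where
  "energy f = (\<Sum>k. (1/2) ^ k * (f (from_nat k))\<^sup>2)"

lemma energy_term_bound:
  assumes "\<And>C. \<bar>f C\<bar> \<le> (1::real)"
  shows "norm ((1/2) ^ k * (f C)\<^sup>2) \<le> (1/2) ^ k"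
  using assms[of C] by (simp add: abs_square_le_1)

lemma energy_summable:
  assumes "\<And>C. \<bar>f C\<bar> \<le> (1::real)"
  shows "summable (\<lambda>k. (1/2) ^ k * (f (from_nat k))\<^sup>2)"
  by (rule summable_comparison_test'[of "\<lambda>k. (1/2) ^ k" 0])
    (use energy_term_bound[of f, OF assms] in \<open>auto simp: summable_geometric\<close>)

lemma energy_le_2:
  assumes "\<And>C. \<bar>f C\<bar> \<le> (1::real)"
  shows "energy f \<le> 2"
proof -
  have "energy f \<le> (\<Sum>k. (1/2) ^ k)"
    unfolding energy_def
    by (intro suminf_le energy_summable assms summable_geometric)
      (use energy_term_bound[of f, OF assms] in \<open>auto dest: abs_le_D1\<close>)
  then show ?thesis by (simp add: suminf_geometric)
qed

lemma energy_tendsto: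
  assumes bd: "\<And>k C. \<bar>f k C\<bar> \<le> (1::real)" and lim: "\<And>C. (\<lambda>k. f k C) \<longlonglongrightarrow> p C"
  shows "(\<lambda>k. energy (f k)) \<longlonglongrightarrow> energy p"
  unfolding energy_def
proof (rule tannerys_theorem[THEN conjunct2, THEN conjunct2])
  show "\<And>j. (\<lambda>k. (1/2) ^ j * (f k (from_nat j))\<^sup>2) \<longlonglongrightarrow> (1/2) ^ j * (p (from_nat j))\<^sup>2"
    by (intro tendsto_intros lim)
  show "summable (\<lambda>k. (1/2::real) ^ k)" by (simp add: summable_geometric)
  show "\<forall>\<^sub>F (j, k) in sequentially \<times>\<^sub>F sequentially. norm ((1/2) ^ j * (f k (from_nat j))\<^sup>2) \<le> (1/2) ^ j"
    using energy_term_bound[of "f _", OF bd] by (intro always_eventually) auto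
qed simp

text \<open>The parallelogram-type identity \<open>energy p = t * energy q + (1 - t) * energy r - t
  * (1 - t) * energy (q - r)\<close> turns maximality of \<open>p\<close> into vanishing energy of
  the difference.\<close>

lemma energy_strictly_convex:
  fixes q r :: "'a::countable list \<Rightarrow> real"
  assumes q: "\<And>C. q C \<in> {0..1}" and r: "\<And>C. r C \<in> {0..1}" and t: "0 < t" "t < 1"
    and p: "\<And>C. p C = t * q C + (1 - t) * r C"
    and le: "energy q \<le> energy p" "energy r \<le> energy p"
  shows "q C = r C"
proof -
  have bd: "\<bar>q C\<bar> \<le> 1" "\<bar>r C\<bar> \<le> 1" "\<bar>q C - r C\<bar> \<le> 1" for C using q[of C] r[of C] by auto
  note sm = energy_summable[of q, OF bd(1)] energy_summable[of r, OF bd(2)]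
    energy_summable[of "\<lambda>C. q C - r C", OF bd(3)]
  have "energy p = (\<Sum>k. t * ((1/2) ^ k * (q (from_nat k))\<^sup>2) + (1 - t) * ((1/2) ^ k * (r (from_nat k))\<^sup>2)
      - t * (1 - t) * ((1/2) ^ k * (q (from_nat k) - r (from_nat k))\<^sup>2))"
    unfolding energy_def p by (intro suminf_cong) (simp add: power2_eq_square algebra_simps)
  also have "\<dots> = t * energy q + (1 - t) * energy r - t * (1 - t) * energy (\<lambda>C. q C - r C)"
    unfolding energy_def
    by (intro sums_unique[symmetric] sums_diff sums_add sums_mult summable_sums sm)
  finally have eq: "energy p = t * energy q + (1 - t) * energy r - t * (1 - t) * energy (\<lambda>C. q C - r C)" .
  have "t * energy q + (1 - t) * energy r \<le> t * energy p + (1 - t) * energy p"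
    by (intro add_mono mult_left_mono le) (use t in auto)
  then have "t * (1 - t) * energy (\<lambda>C. q C - r C) \<le> 0" unfolding eq by (simp add: algebra_simps)
  then have "energy (\<lambda>C. q C - r C) \<le> 0" using t by (simp add: mult_le_0_iff)
  moreover have "0 \<le> energy (\<lambda>C. q C - r C)"
    unfolding energy_def using sm(3) by (intro suminf_nonneg) auto
  ultimately have "(\<Sum>k. (1/2) ^ k * (q (from_nat k) - r (from_nat k))\<^sup>2) = 0"
    unfolding energy_def by linarith
  then have "\<forall>k. (1/2) ^ k * (q (from_nat k) - r (from_nat k))\<^sup>2 = 0"
    using suminf_eq_zero_iff[OF sm(3)] by simp
  from this[rule_format, of "to_nat C"] show ?thesis by simp
qed

text \<open>\<open>s\<close> is the largest lower bound for all masses that a normalised weight can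
  have, \<open>F\<close> the set of weights attaining it, and \<open>p\<close> has maximal energy in
  \<open>F\<close>. If \<open>p\<close> is a proper mixture, both components lie in \<open>F\<close>
  because the limit of the masses is affine, and strict convexity makes them equal.\<close>

lemma extreme_weight_exists:
  fixes L H :: "'a::finite list set"
  assumes H: "hereditary H" and p0: "invariant_weight L p0" "p0 [] = 1" "\<And>n. \<delta> \<le> mass H p0 n"
  obtains p where "extreme_weight L p" "\<And>n. \<delta> \<le> mass H p n"
proof -
  define P where "P = {p. invariant_weight L p \<and> p [] = 1}"
  have P01: "p C \<in> {0..1}" if "p \<in> P" for p C
    using that invariant_weightD(1)[of L p C] invariant_weight_le[of L p C] by (auto simp: P_def)
  define S where "S = {t. \<exists>p\<in>P. \<forall>n. t \<le> mass H p n}"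
  have bdd: "bdd_above S"
  proof (rule bdd_aboveI)
    fix t assume "t \<in> S"
    then obtain p where "p \<in> P" "t \<le> mass H p 0" by (auto simp: S_def)
    then show "t \<le> 1" using mass_le_total[of L p H 0] by (auto simp: P_def)
  qed
  have "\<delta> \<in> S" using p0 by (auto simp: S_def P_def)
  then have ne: "S \<noteq> {}" by auto
  define s where "s = Sup S"
  have s: "\<delta> \<le> s" unfolding s_def using \<open>\<delta> \<in> S\<close> bdd by (rule cSup_upper)
  have le_s: "t \<le> s" if "p \<in> P" "\<And>n. t \<le> mass H p n" for t p
    unfolding s_def by (rule cSup_upper[OF _ bdd]) (use that in \<open>auto simp: S_def\<close>)
  define F where "F = {p\<in>P. \<forall>n. s \<le> mass H p n}"
  \<comment> \<open>Used twice: with almost optimal weights to see that \<open>F\<close> is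
    nonempty, and with elements of \<open>F\<close> to see that the supremum of the energy is
    attained.\<close>
  have lim_in: "\<exists>r p. strict_mono r \<and> (\<forall>C. (\<lambda>k. f (r k) C) \<longlonglongrightarrow> p C) \<and> p \<in> F"
    if f: "\<And>k. f k \<in> P" "\<And>k n. s - 1 / Suc k \<le> mass H (f k) n" for f
  proof -
    from f(1) obtain r p where rp: "strict_mono (r :: nat \<Rightarrow> nat)" "\<And>C. (\<lambda>k. f (r k) C) \<longlonglongrightarrow> p C"
      "invariant_weight L p" "p [] = 1"
      by (rule_tac invariant_weight_compact[of L f]) (auto simp: P_def)
    have "s \<le> mass H p n" for n
    proof (rule LIMSEQ_le)
      show "(\<lambda>k. mass H (f (r k)) n) \<longlonglongrightarrow> mass H p n"
        unfolding mass_def by (intro tendsto_intros rp)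
      have "(\<lambda>k. s - 1 / Suc k) \<longlonglongrightarrow> s - 0" by (intro tendsto_intros LIMSEQ_Suc lim_const_over_n)
      then show "(\<lambda>k. s - 1 / Suc (r k)) \<longlonglongrightarrow> s"
        using LIMSEQ_subseq_LIMSEQ[OF _ rp(1)] by (fastforce simp: o_def)
    qed (use f(2) in blast)
    with rp show ?thesis by (auto simp: F_def P_def)
  qed
  have "\<exists>p\<in>P. \<forall>n. s - 1 / Suc k \<le> mass H p n" for k
  proof -
    have "s - 1 / Suc k < Sup S" by (simp add: s_def)
    then obtain t where "t \<in> S" "s - 1 / Suc k < t" using less_cSup_iff[OF ne bdd] by blast
    then show ?thesis unfolding S_def by (blast intro: order_trans less_imp_le)
  qed
  then obtain f where "\<And>k. f k \<in> P" "\<And>k n. s - 1 / Suc k \<le> mass H (f k) n" by metis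
  from lim_in[OF this] have Fne: "F \<noteq> {}" by auto
  have F01: "\<bar>p C\<bar> \<le> 1" if "p \<in> F" for p C using P01[of p C] that by (auto simp: F_def)
  have bddE: "bdd_above (energy ` F)"
    by (rule bdd_aboveI[of _ 2]) (auto intro!: energy_le_2 F01)
  have "\<exists>p\<in>F. Sup (energy ` F) - 1 / Suc k < energy p" for k
    using less_cSup_iff[of "energy ` F" "Sup (energy ` F) - 1 / Suc k"] Fne bddE by auto
  then obtain g where g: "\<And>k. g k \<in> F" "\<And>k. Sup (energy ` F) - 1 / Suc k < energy (g k)" by metis
  have "s - 1 / Suc k \<le> mass H (g k) n" for k n
  proof -
    have "s \<le> mass H (g k) n" "0 \<le> 1 / real (Suc k)" using g(1)[of k] by (auto simp: F_def)
    then show ?thesis by linarith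
  qed
  moreover have "g k \<in> P" for k using g(1) by (auto simp: F_def)
  ultimately obtain r p where rp: "strict_mono (r :: nat \<Rightarrow> nat)" "\<And>C. (\<lambda>k. g (r k) C) \<longlonglongrightarrow> p C" "p \<in> F"
    using lim_in[of g] by blast
  have max: "energy q \<le> energy p" if "q \<in> F" for q
  proof -
    have "Sup (energy ` F) \<le> energy p"
    proof (rule LIMSEQ_le)
      show "(\<lambda>k. energy (g (r k))) \<longlonglongrightarrow> energy p"
        by (rule energy_tendsto[OF F01]) (use g rp in auto)
      have "(\<lambda>k. Sup (energy ` F) - 1 / Suc k) \<longlonglongrightarrow> Sup (energy ` F) - 0"
        by (intro tendsto_intros LIMSEQ_Suc lim_const_over_n)
      then show "(\<lambda>k. Sup (energy ` F) - 1 / Suc (r k)) \<longlonglongrightarrow> Sup (energy ` F)"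
        using LIMSEQ_subseq_LIMSEQ[OF _ rp(1)] by (fastforce simp: o_def)
    qed (use g(2) less_imp_le in blast)
    then show ?thesis using cSup_upper[OF imageI[OF that] bddE] by linarith
  qed
  have pP: "invariant_weight L p" "p [] = 1" and ps: "\<And>n. s \<le> mass H p n"
    using rp(3) by (auto simp: F_def P_def)
  have ext: "q C = q [] * p C"
    if qr: "invariant_weight L q" "invariant_weight L r" "\<And>C. p C = q C + r C" for q r C
  proof -
    \<comment> \<open>\<open>t\<close> is the share of \<open>q\<close> in the mixture. For
      \<open>t = 0\<close> or \<open>t = 1\<close> one summand vanishes; otherwise both are
      normalised.\<close>
    define t where "t = q []"
    have t': "r [] = 1 - t" using qr(3)[of "[]"] pP(2) by (simp add: t_def)
    have t01: "0 \<le> t" "t \<le> 1"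
      using invariant_weightD(1)[OF qr(1), of "[]"] invariant_weightD(1)[OF qr(2), of "[]"] t'
      by (auto simp: t_def)
    consider "t = 0" | "t = 1" | "0 < t" "t < 1" using t01 by linarith
    then show ?thesis
    proof cases
      case 1
      then show ?thesis
        using invariant_weight_le[OF qr(1), of C] invariant_weightD(1)[OF qr(1), of C] by (simp add: t_def)
    next
      case 2
      then have "r C = 0"
        using invariant_weight_le[OF qr(2), of C] invariant_weightD(1)[OF qr(2), of C] t' by simp
      then show ?thesis using 2 qr(3)[of C] by (simp add: t_def)
    next
      case 3
      define q' where "q' C = (1 / t) * q C" for C
      define r' where "r' C = (1 / (1 - t)) * r C" for C
      have inP: "q' \<in> P" "r' \<in> P"
        using 3 t' invariant_weight_scale[OF qr(1), of "1 / t"] invariant_weight_scale[OF qr(2), of "1 / (1 - t)"]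
        by (auto simp: P_def q'_def[abs_def] r'_def[abs_def] t_def)
      have p: "p C = t * q' C + (1 - t) * r' C" for C
        using 3 qr(3) by (simp add: q'_def r'_def)
      have lims: "\<exists>l. (\<lambda>n. mass H f n) \<longlonglongrightarrow> l \<and> (\<forall>n. l \<le> mass H f n)" if "f \<in> P" for f
      proof -
        have f: "invariant_weight L f" using that by (auto simp: P_def)
        show ?thesis
          using decseq_convergent[of "mass H f" 0] mass_nonneg[OF f] mass_Suc_le[OF f H]
          by (metis decseq_SucI)
      qed
      obtain a where a: "mass H q' \<longlonglongrightarrow> a" "\<And>n. a \<le> mass H q' n" using lims[OF inP(1)] by auto
      obtain b where b: "mass H r' \<longlonglongrightarrow> b" "\<And>n. b \<le> mass H r' n" using lims[OF inP(2)] by auto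
      have as: "a \<le> s" and bs: "b \<le> s" using le_s a b inP by blast+
      have massp: "mass H p n = t * mass H q' n + (1 - t) * mass H r' n" for n
        unfolding mass_def p by (simp add: sum.distrib sum_distrib_left)
      have "s \<le> t * a + (1 - t) * b"
      proof (rule LIMSEQ_le_const)
        show "(\<lambda>n. mass H p n) \<longlonglongrightarrow> t * a + (1 - t) * b"
          unfolding massp by (intro tendsto_intros a b)
      qed (use ps in blast)
      moreover have "(1 - t) * b \<le> (1 - t) * s" "t * a \<le> t * s" using as bs 3 by auto
      \<comment> \<open>The average of \<open>a\<close> and \<open>b\<close> is at least
        \<open>s\<close> while neither exceeds \<open>s\<close>, so both equal
        \<open>s\<close>.\<close>
      ultimately have "t * s \<le> t * a" "(1 - t) * s \<le> (1 - t) * b" by (auto simp: algebra_simps)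
      then have "s \<le> a" "s \<le> b" using 3 by auto
      then have "q' \<in> F" "r' \<in> F" using inP a(2) b(2) by (auto simp: F_def intro: order_trans)
      then have "q' C = r' C" for C
        using energy_strictly_convex[of q' r' t p C] P01[OF inP(1)] P01[OF inP(2)] 3 p max by blast
      then have "p C = q' C" by (simp add: p algebra_simps)
      then show ?thesis using 3 by (simp add: q'_def t_def)
    qed
  qed
  show ?thesis
  proof
    show "extreme_weight L p" using pP ext by (auto simp: extreme_weight_def)
    show "\<delta> \<le> mass H p n" for n using ps[of n] s by simp
  qed
qed

section \<open>Concentration of frequencies\<close>

lemma extreme_weightD:
  assumes "extreme_weight L p" "invariant_weight L q" "invariant_weight L r" "\<And>C. p C = q C + r C"
  shows "q C = q [] * p C"
  using assms(1) unfolding extreme_weight_def using assms(2-4) by blast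

text \<open>
  If words with a one-sided deviation of at least \<open>\<epsilon>\<close> kept weight \<open>\<tau>\<close>, the averages of their
  frequencies would accumulate at an invariant summand of \<open>p\<close> that is not a multiple of \<open>p\<close>.
\<close>

lemma extreme_weight_deviation:
  fixes L :: "'a::finite list set"
  assumes fac: "factor_closed L" and ext: "extreme_weight L p" and \<epsilon>: "0 < \<epsilon>" and \<tau>: "0 < \<tau>"
  shows "eventually (\<lambda>n. (\<Sum>B\<in>{B\<in>words n. \<epsilon> \<le> \<sigma> * (freq B C - p C)}. p B) < \<tau>) sequentially"
proof (rule ccontr)
  have p: "invariant_weight L p" "p [] = 1" using ext by (auto simp: extreme_weight_def)
  define D where "D n = {B\<in>words n. \<epsilon> \<le> \<sigma> * (freq B C - p C)}" for n
  \<comment> \<open>\<open>p\<close> is cut into its part on the deviating words and the rest; the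
    averaged frequencies of the two parts converge to the two summands of \<open>p\<close>.\<close>
  define wt where "wt k B = (if B \<in> D k then p B else 0)" for k B
  define wt' where "wt' k B = (if B \<in> D k then 0 else p B)" for k B
  have wt_sum: "wt k B + wt' k B = p B" for k B by (simp add: wt_def wt'_def)
  have pos: "0 \<le> p B" for B by (rule invariant_weightD(1)[OF p(1)])
  have w: "0 \<le> wt k B" "0 \<le> wt' k B" "B \<notin> L \<Longrightarrow> wt k B = 0" "B \<notin> L \<Longrightarrow> wt' k B = 0"
    "wt k B \<le> p B" "wt' k B \<le> p B" for k B
    using pos invariant_weightD(4)[OF p(1)] by (auto simp: wt_def wt'_def)
  have tot: "(\<Sum>B\<in>words k. wt k B) \<le> 1" "(\<Sum>B\<in>words k. wt' k B) \<le> 1" for k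
    using sum_mono[of "words k" "wt k" p] sum_mono[of "words k" "wt' k" p] w(5,6)
    by (simp_all add: invariant_weight_total[OF p(1)] p(2))
  define c where "c k E = (\<Sum>B\<in>words k. wt k B * freq B E)" for k E
  define c' where "c' k E = (\<Sum>B\<in>words k. wt' k B * freq B E)" for k E
  have c_le: "c k E \<in> {0..2}" for k E
  proof -
    have "c k E \<le> (\<Sum>B\<in>words k. wt k B * 2)"
      unfolding c_def by (intro sum_mono mult_left_mono freq_le_2 w)
    also have "\<dots> \<le> 2" using tot(1)[of k] by (simp flip: sum_distrib_right)
    finally show ?thesis using w(1) by (auto simp: c_def intro!: sum_nonneg)
  qed
  \<comment> \<open>Since \<open>c + c'\<close> is the known mean frequency, \<open>c'\<close>
    converges wherever \<open>c\<close> does and no second subsequence is needed.\<close>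
  have cc': "c' k E = card {i. i + length E \<le> k} / k * p E - c k E" for k E
  proof -
    have "c k E + c' k E = (\<Sum>B\<in>words k. p B * freq B E)"
      unfolding c_def c'_def by (simp add: wt_sum flip: sum.distrib distrib_right)
    then show ?thesis by (simp add: invariant_weight_mean_freq[OF p(1)])
  qed
  have massD: "(\<Sum>B\<in>words k. wt k B) = (\<Sum>B\<in>D k. p B)" for k
    by (simp add: wt_def D_def sum.inter_filter)
  assume "\<not> ?thesis"
  then have "\<exists>\<^sub>F n in sequentially. \<tau> \<le> (\<Sum>B\<in>D n. p B)"
    by (simp add: D_def not_eventually not_less)
  then have "infinite {n. \<tau> \<le> (\<Sum>B\<in>D n. p B)}"
    by (simp add: frequently_cofinite flip: cofinite_eq_sequentially)
  from infinite_enumerate[OF this] obtain r0 :: "nat \<Rightarrow> nat"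
    where r0: "strict_mono r0" "\<And>k. \<tau> \<le> (\<Sum>B\<in>D (r0 k). p B)" by auto
  obtain r1 q where r1: "strict_mono r1" and q1: "\<And>E. (\<lambda>k. c (r0 (r1 k)) E) \<longlonglongrightarrow> q E"
    by (rule pointwise_subsequence[of "\<lambda>k. c (r0 k)" 2]) (use c_le in auto)
  define r where "r = r0 \<circ> r1"
  have r: "strict_mono r" unfolding r_def using r0(1) r1 by (rule strict_mono_o)
  have q: "(\<lambda>k. c (r k) E) \<longlonglongrightarrow> q E" for E using q1 by (simp add: r_def)
  have frac: "(\<lambda>k. card {i. i + l \<le> r k} / r k) \<longlonglongrightarrow> 1" for l
    using LIMSEQ_subseq_LIMSEQ[OF mean_freq_factor_tendsto[of l] r] by (simp add: o_def)
  have q': "(\<lambda>k. c' (r k) E) \<longlonglongrightarrow> 1 * p E - q E" for E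
    unfolding cc' by (intro tendsto_intros frac q)
  have inv_q: "invariant_weight L q"
    by (rule invariant_weight_limit[OF fac _ _ _ r q[unfolded c_def]]) (use w tot in auto)
  have inv_q': "invariant_weight L (\<lambda>E. 1 * p E - q E)"
    by (rule invariant_weight_limit[OF fac _ _ _ r q'[unfolded c'_def]]) (use w tot in auto)
  have "q C = q [] * p C"
    by (rule extreme_weightD[OF ext inv_q inv_q']) simp
  \<comment> \<open>The empty word has frequency \<open>(k + 1) / k\<close>, so \<open>q []\<close>
    equals the mass of the deviating words only in the limit.\<close>
  have c_Nil: "c k [] = card {i. i + 0 \<le> k} / k * (\<Sum>B\<in>D k. p B)" for k
  proof -
    have "c k [] = (\<Sum>B\<in>words k. wt k B * (card {i. i + 0 \<le> k} / k))"
      unfolding c_def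
      by (intro sum.cong refl) (simp add: freq_eq occurrences_Nil words_def atMost_def)
    then show ?thesis by (simp only: massD mult.commute flip: sum_distrib_right)
  qed
  have ev1: "eventually (\<lambda>k. k \<ge> 1) sequentially" by (rule eventually_ge_at_top)
  have rk: "1 \<le> r k" if "1 \<le> k" for k using that seq_suble[OF r, of k] by linarith
  have mass_lim: "(\<lambda>k. \<Sum>B\<in>D (r k). p B) \<longlonglongrightarrow> q []"
  proof -
    have "(\<lambda>k. c (r k) [] / (card {i. i + 0 \<le> r k} / r k)) \<longlonglongrightarrow> q [] / 1"
      by (intro tendsto_intros q frac) simp
    moreover have "eventually (\<lambda>k. c (r k) [] / (card {i. i + 0 \<le> r k} / r k) = (\<Sum>B\<in>D (r k). p B)) sequentially"
      using ev1
    proof eventually_elim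
      case (elim k)
      have "{i. i + 0 \<le> r k} = {..r k}" by auto
      then show ?case unfolding c_Nil using rk[OF elim] by simp
    qed
    ultimately show ?thesis using Lim_transform_eventually by fastforce
  qed
  have "\<tau> \<le> q []"
    by (rule LIMSEQ_le_const[OF mass_lim]) (use r0(2) in \<open>auto simp: r_def\<close>)
  \<comment> \<open>Every word of \<open>D k\<close> deviates by at least \<epsilon> in the same
    direction, so deviations cannot cancel. In the limit the right side vanishes by extremality,
    whereas \<open>q []\<close> is at least \<tau>.\<close>
  have "\<epsilon> * (\<Sum>B\<in>D k. p B) \<le> \<sigma> * (c k C - p C * (\<Sum>B\<in>D k. p B))" for k
  proof -
    have "\<epsilon> * (\<Sum>B\<in>D k. p B) \<le> (\<Sum>B\<in>D k. p B * (\<sigma> * (freq B C - p C)))"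
      unfolding sum_distrib_left
      by (intro sum_mono) (use pos in \<open>auto simp: D_def mult.commute[of \<epsilon>] intro!: mult_left_mono\<close>)
    also have "\<dots> = \<sigma> * ((\<Sum>B\<in>D k. p B * freq B C) - p C * (\<Sum>B\<in>D k. p B))"
      by (simp add: sum_distrib_left algebra_simps flip: sum_subtractf)
    also have "(\<Sum>B\<in>D k. p B * freq B C) = c k C"
      unfolding c_def wt_def D_def by (subst sum.inter_filter) (auto intro!: sum.cong)
    finally show ?thesis .
  qed
  moreover have "(\<lambda>k. \<epsilon> * (\<Sum>B\<in>D (r k). p B)) \<longlonglongrightarrow> \<epsilon> * q []"
    and "(\<lambda>k. \<sigma> * (c (r k) C - p C * (\<Sum>B\<in>D (r k). p B))) \<longlonglongrightarrow> \<sigma> * (q C - p C * q [])"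
    by (intro tendsto_intros mass_lim q)+
  ultimately have "\<epsilon> * q [] \<le> \<sigma> * (q C - p C * q [])"
    using LIMSEQ_le by blast
  then have "\<epsilon> * q [] \<le> 0" using \<open>q C = q [] * p C\<close> by simp
  then show False using \<epsilon> \<tau> \<open>\<tau> \<le> q []\<close> by (simp add: mult_le_0_iff)
qed

text \<open>Union bound over the words of \<open>F\<close> and the two signs of the
  deviation.\<close>

lemma extreme_weight_concentration:
  fixes L :: "'a::finite list set"
  assumes fac: "factor_closed L" and ext: "extreme_weight L p" and "0 < \<epsilon>" "0 < \<tau>" and "finite F"
  shows "eventually (\<lambda>n. (\<Sum>B\<in>{B\<in>words n. \<exists>C\<in>F. \<epsilon> \<le> \<bar>freq B C - p C\<bar>}. p B) < \<tau>) sequentially"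
proof -
  define K where "K = F \<times> {1, -1::real}"
  have finK: "finite K" using assms by (simp add: K_def)
  define D where "D n = (\<lambda>(C, \<sigma>). {B\<in>words n. \<epsilon> \<le> \<sigma> * (freq B C - p C)})" for n
  have pos: "0 \<le> p B" for B using ext by (auto simp: extreme_weight_def invariant_weight_def)
  \<comment> \<open>The added 1 makes the final estimate strict and covers an empty
    \<open>F\<close>.\<close>
  have "eventually (\<lambda>n. \<forall>x\<in>K. (\<Sum>B\<in>D n x. p B) < \<tau> / (card K + 1)) sequentially"
    unfolding D_def using assms
    by (intro eventually_ball_finite[OF finK] ballI) (auto intro!: extreme_weight_deviation[OF fac ext])
  then show ?thesis
  proof eventually_elim
    case (elim n)
    have "(\<Sum>B\<in>{B\<in>words n. \<exists>C\<in>F. \<epsilon> \<le> \<bar>freq B C - p C\<bar>}. p B) \<le> (\<Sum>B\<in>(\<Union>x\<in>K. D n x). p B)"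
      by (rule sum_mono2) (use finK pos in \<open>auto simp: K_def D_def abs_if split: if_splits\<close>)
    also have "\<dots> \<le> (\<Sum>(x, B)\<in>Sigma K (D n). p B)"
      by (rule sum_le_included[where i = snd]) (use finK pos in \<open>auto simp: D_def\<close>)
    also have "\<dots> = (\<Sum>x\<in>K. \<Sum>B\<in>D n x. p B)"
      by (rule sum.Sigma[symmetric]) (use finK in \<open>auto simp: D_def\<close>)
    also have "\<dots> \<le> (\<Sum>x\<in>K. \<tau> / (card K + 1))"
      by (intro sum_mono) (use elim in \<open>auto intro: less_imp_le\<close>)
    also have "\<dots> < \<tau>" using assms(4) by (simp add: field_simps)
    finally show ?case .
  qed
qed

text \<open>The words of \<open>H\<close> weigh at least \<delta>, the atypical words less; hence
  \<open>H\<close> contains a typical word of positive weight, and positive weight puts it into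
  \<open>L\<close>.\<close>

lemma heavy_hereditary_typical:
  fixes L :: "'a::finite list set"
  assumes fac: "factor_closed L" and ext: "extreme_weight L p" and "0 < \<delta>" "\<And>n. \<delta> \<le> mass H p n"
    and "0 < \<epsilon>" "finite F"
  obtains B where "B \<in> H" "B \<in> L" "n0 \<le> length B" "\<And>C. C \<in> F \<Longrightarrow> \<bar>freq B C - p C\<bar> < \<epsilon>"
proof -
  have p: "invariant_weight L p" using ext by (simp add: extreme_weight_def)
  have "eventually (\<lambda>n. (\<Sum>B\<in>{B\<in>words n. \<exists>C\<in>F. \<epsilon> \<le> \<bar>freq B C - p C\<bar>}. p B) < \<delta> \<and> n0 \<le> n) sequentially"
    using extreme_weight_concentration[OF fac ext] assms eventually_ge_at_top[of n0]
    by (intro eventually_conj) auto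
  then obtain n where n: "(\<Sum>B\<in>{B\<in>words n. \<exists>C\<in>F. \<epsilon> \<le> \<bar>freq B C - p C\<bar>}. p B) < \<delta>" "n0 \<le> n"
    using eventually_happens'[of sequentially] by auto
  have "\<exists>B\<in>H \<inter> words n. 0 < p B \<and> (\<forall>C\<in>F. \<bar>freq B C - p C\<bar> < \<epsilon>)"
  proof (rule ccontr)
    assume neg: "\<not> ?thesis"
    have "mass H p n = (\<Sum>B\<in>{B\<in>H \<inter> words n. p B \<noteq> 0}. p B)"
      unfolding mass_def by (rule sum.mono_neutral_right) auto
    also have "\<dots> \<le> (\<Sum>B\<in>{B\<in>words n. \<exists>C\<in>F. \<epsilon> \<le> \<bar>freq B C - p C\<bar>}. p B)"
    proof (rule sum_mono2)
      have "0 < p B" if "p B \<noteq> 0" for B using that invariant_weightD(1)[OF p, of B] by linarith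
      with neg show "{B\<in>H \<inter> words n. p B \<noteq> 0} \<subseteq> {B\<in>words n. \<exists>C\<in>F. \<epsilon> \<le> \<bar>freq B C - p C\<bar>}"
        by fastforce
    qed (auto intro: invariant_weightD(1)[OF p])
    finally have "mass H p n \<le> (\<Sum>B\<in>{B\<in>words n. \<exists>C\<in>F. \<epsilon> \<le> \<bar>freq B C - p C\<bar>}. p B)" .
    then show False using n assms(4)[of n] by linarith
  qed
  then obtain B where "B \<in> H \<inter> words n" "0 < p B" "\<forall>C\<in>F. \<bar>freq B C - p C\<bar> < \<epsilon>" by blast
  moreover from this have "B \<in> L" using invariant_weightD(4)[OF p, of B] by force
  ultimately show ?thesis using that[of B] n(2) by (auto simp: words_def)
qed

text \<open>The initial weight is a limit of the frequencies in the \<open>B N\<close>. The loss of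
  \<open>n\<close> in \<open>dense\<close> allows for windows cut off by an end of
  \<open>B N\<close>; it disappears after division by \<open>N\<close>.\<close>

lemma hereditary_sparse:
  fixes L H :: "'a::finite list set" and \<delta> :: real and B :: "nat \<Rightarrow> 'a list"
  assumes fac: "factor_closed L" and H: "hereditary H"
    and B: "\<And>N. B N \<in> L" "\<And>N. length (B N) = N"
    and dense: "\<And>N n. 1 \<le> N \<Longrightarrow> \<delta> * N - n \<le> card {i. i + n \<le> N \<and> take n (drop i (B N)) \<in> H}"
  obtains p where "extreme_weight L p" "\<And>n. \<delta> \<le> mass H p n"
proof -
  define wt where "wt k A = (if A = B k then 1 else 0 :: real)" for k A
  have wt: "(\<Sum>A\<in>words k. wt k A * g A) = g (B k)" for k g
  proof -
    have "(\<Sum>A\<in>words k. wt k A * g A) = (\<Sum>A\<in>words k. if A = B k then g A else 0)"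
      by (intro sum.cong refl) (simp add: wt_def)
    then show ?thesis using B by (simp add: words_def sum.delta finite_words[unfolded words_def])
  qed
  obtain r p0 where r: "strict_mono r" "\<And>C. (\<lambda>k. freq (B (r k)) C) \<longlonglongrightarrow> p0 C"
    by (rule pointwise_subsequence[of "\<lambda>k. freq (B k)" 2]) (use freq_le_2 in auto)
  have inv: "invariant_weight L p0"
  proof (rule invariant_weight_limit[OF fac, of wt r])
    show "(\<lambda>k. \<Sum>A\<in>words (r k). wt (r k) A * freq A C) \<longlonglongrightarrow> p0 C" for C
      unfolding wt by (rule r)
    show "(\<Sum>A\<in>words k. wt k A) \<le> 1" for k using wt[of k "\<lambda>_. 1"] by simp
  qed (use r(1) B in \<open>auto simp: wt_def\<close>)
  have rk: "1 \<le> r k" if "1 \<le> k" for k using that seq_suble[OF r(1), of k] by linarith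
  have "freq (B k) [] = card {i. i + 0 \<le> k} / k" for k
    by (simp add: freq_eq occurrences_Nil atMost_def B)
  then have "(\<lambda>k. freq (B (r k)) []) \<longlonglongrightarrow> 1"
    using LIMSEQ_subseq_LIMSEQ[OF mean_freq_factor_tendsto[of 0] r(1)] by (simp add: o_def)
  then have one: "p0 [] = 1" using LIMSEQ_unique r(2) by blast
  have "\<delta> \<le> mass H p0 n" for n
  proof (rule LIMSEQ_le)
    show "(\<lambda>k. \<Sum>C\<in>H \<inter> words n. freq (B (r k)) C) \<longlonglongrightarrow> mass H p0 n"
      unfolding mass_def by (intro tendsto_intros r)
    have "(\<lambda>k. \<delta> - real n / k) \<longlonglongrightarrow> \<delta> - 0" by (intro tendsto_intros lim_const_over_n)
    then show "(\<lambda>k. \<delta> - real n / r k) \<longlonglongrightarrow> \<delta>"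
      using LIMSEQ_subseq_LIMSEQ[OF _ r(1)] by (fastforce simp: o_def)
    show "\<exists>M. \<forall>k\<ge>M. \<delta> - real n / r k \<le> (\<Sum>C\<in>H \<inter> words n. freq (B (r k)) C)"
    proof (intro exI[of _ 1] allI impI)
      fix k :: nat assume "1 \<le> k"
      then have k: "1 \<le> r k" by (rule rk)
      have "\<delta> - real n / r k = (\<delta> * r k - n) / r k" using k by (simp add: field_simps)
      also have "\<dots> \<le> (\<Sum>C\<in>H \<inter> words n. freq (B (r k)) C)"
        unfolding sum_freq_words B by (intro divide_right_mono dense k) simp
      finally show "\<delta> - real n / r k \<le> (\<Sum>C\<in>H \<inter> words n. freq (B (r k)) C)" .
    qed
  qed
  with extreme_weight_exists[OF H inv one] that show ?thesis by metis
qed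

section \<open>From invariant weights to measures\<close>

lemma length_block [simp]: "length (block x i n) = n"
  by (simp add: block_def)

lemma block_in_words [simp]: "block x i n \<in> words n"
  by (simp add: words_def)

lemma take_drop_block:
  "a + n \<le> k \<Longrightarrow> take n (drop a (block x i k)) = block x (i + of_nat a) n"
  by (rule nth_equalityI) (auto simp: block_def add.assoc)

lemma block_eq_iff: "block x i n = block y j n \<longleftrightarrow> (\<forall>a<n. x (i + of_nat a) = y (j + of_nat a))"
  by (auto simp: block_def)

lemma block_shift: "block (shift x) i n = block x (i + 1) n"
  by (simp add: block_def shift_def add_ac)

text \<open>Unlike \<open>blocks\<close>, this admits the empty word, which is a factor of every
  word and carries the total mass of a weight.\<close>

definition lang :: "('i::linordered_semidom \<Rightarrow> 'a) set \<Rightarrow> 'a list set" where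
  "lang X = {block x i n | x i n. x \<in> X}"

lemma factor_closed_lang:
  fixes X :: "('i::linordered_semidom \<Rightarrow> 'a) set"
  shows "factor_closed (lang X)"
  unfolding factor_closed_def
proof (intro allI impI)
  fix U C V :: "'a list" assume "U @ C @ V \<in> lang X"
  then obtain x i n where x: "x \<in> X" "U @ C @ V = block x i n" by (auto simp: lang_def)
  have n: "length U + length C \<le> n" using arg_cong[OF x(2), of length] by simp
  have "C = take (length C) (drop (length U) (U @ C @ V))" by simp
  also have "\<dots> = block x (i + of_nat (length U)) (length C)" unfolding x(2) by (rule take_drop_block[OF n])
  finally show "C \<in> lang X" using x(1) by (auto simp: lang_def)
qed

text \<open>
  The windows \<open>[w k, w k + wl k)\<close> exhaust the coordinates and every block of \<open>X\<close> occurs at the start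
  of every window: windows around \<open>0\<close> in the two-sided case, initial segments in the one-sided case.
\<close>

locale windowed_subshift =
  fixes X :: "('i::{discrete_linordered_semidom, countable} \<Rightarrow> 'a::{finite, discrete_topology}) set"
    and w :: "nat \<Rightarrow> 'i" and wl :: "nat \<Rightarrow> nat"
  assumes closed_X: "closed X"
    and shift_in: "x \<in> X \<Longrightarrow> shift x \<in> X"
    and realize: "x \<in> X \<Longrightarrow> \<exists>y\<in>X. \<forall>j. y (w k + of_nat j) = x (i + of_nat j)"
    and window: "\<forall>\<^sub>F k in sequentially. \<exists>a. i = w k + of_nat a \<and> a + n \<le> wl k"
begin

section \<open>Cylinders and the Borel sets of the subshift\<close>

definition cyl :: "'i \<Rightarrow> nat \<Rightarrow> 'a list set \<Rightarrow> ('i \<Rightarrow> 'a) set" where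
  "cyl i n Q = {x\<in>X. block x i n \<in> Q}"

text \<open>Sets \<open>Q\<close> of words, and not single words, make the family closed under
  complements and unions.\<close>

definition cylinders :: "('i \<Rightarrow> 'a) set set" where
  "cylinders = {cyl i n Q | i n Q. Q \<subseteq> words n}"

lemma cyl_subset: "cyl i n Q \<subseteq> X"
  by (auto simp: cyl_def)

lemma cylinders_Pow: "cylinders \<subseteq> Pow X"
  by (auto simp: cylinders_def cyl_def)

lemma cyl_in_cylinders: "cyl i n Q \<in> cylinders"
proof -
  have "cyl i n Q = cyl i n (Q \<inter> words n)" by (auto simp: cyl_def)
  then show ?thesis by (auto simp: cylinders_def)
qed

text \<open>A large window contains the coordinates of the cylinder, and its words can be tested on
  the corresponding factor. Any two cylinders thus live on a common window.\<close>

lemma cylinders_window: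
  assumes "A \<in> cylinders"
  shows "\<forall>\<^sub>F k in sequentially. \<exists>Q\<subseteq>words (wl k). A = cyl (w k) (wl k) Q"
proof -
  from assms obtain i n Q where A: "A = cyl i n Q" "Q \<subseteq> words n" by (auto simp: cylinders_def)
  from window[of i n] show ?thesis
  proof eventually_elim
    case (elim k)
    then obtain a where a: "i = w k + of_nat a" "a + n \<le> wl k" by auto
    show ?case
      by (rule exI[of _ "{B\<in>words (wl k). take n (drop a B) \<in> Q}"])
        (auto simp: A cyl_def take_drop_block[OF a(2)] a(1))
  qed
qed

lemma cylinders_window2:
  assumes "A \<in> cylinders" "B \<in> cylinders"
  obtains k Q R where "A = cyl (w k) (wl k) Q" "B = cyl (w k) (wl k) R"
    "Q \<subseteq> words (wl k)" "R \<subseteq> words (wl k)"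
proof -
  have "\<forall>\<^sub>F k in sequentially. (\<exists>Q\<subseteq>words (wl k). A = cyl (w k) (wl k) Q) \<and> (\<exists>R\<subseteq>words (wl k). B = cyl (w k) (wl k) R)"
    using assms by (intro eventually_conj cylinders_window)
  from eventually_happens'[OF sequentially_bot this] that show ?thesis by blast
qed

lemma algebra_cylinders: "algebra X cylinders"
  unfolding algebra_iff_Un
proof (intro conjI ballI)
  show "cylinders \<subseteq> Pow X" by (rule cylinders_Pow)
  have "{} = cyl 0 0 {}" by (auto simp: cyl_def)
  then show "{} \<in> cylinders" using cyl_in_cylinders by metis
next
  fix A assume "A \<in> cylinders"
  then obtain i n Q where "A = cyl i n Q" by (auto simp: cylinders_def)
  then have "X - A = cyl i n (- Q)" by (auto simp: cyl_def)
  then show "X - A \<in> cylinders" using cyl_in_cylinders by metis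
next
  fix A B assume "A \<in> cylinders" "B \<in> cylinders"
  then obtain k Q R where "A = cyl (w k) (wl k) Q" "B = cyl (w k) (wl k) R" by (rule cylinders_window2)
  then have "A \<union> B = cyl (w k) (wl k) (Q \<union> R)" by (auto simp: cyl_def)
  then show "A \<union> B \<in> cylinders" using cyl_in_cylinders by metis
qed

lemma Int_stable_cylinders: "Int_stable cylinders"
proof -
  interpret algebra X cylinders by (rule algebra_cylinders)
  show ?thesis by (auto simp: Int_stable_def)
qed

lemma X_in_cylinders: "X \<in> cylinders"
  using algebra.top[OF algebra_cylinders] .

lemma coordinate_vimage: "open {x :: 'i \<Rightarrow> 'a. x i \<in> S}"
proof -
  have "open ((\<lambda>x :: 'i \<Rightarrow> 'a. x i) -` S)"
    by (intro open_vimage open_discrete continuous_on_product_coordinates)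
  then show ?thesis by (simp add: vimage_def)
qed

lemma open_block: "open {x :: 'i \<Rightarrow> 'a. block x i n \<in> Q}"
proof -
  have "{x :: 'i \<Rightarrow> 'a. block x i n \<in> Q} = (\<Union>C\<in>Q \<inter> words n. \<Inter>a<n. {x. x (i + of_nat a) \<in> {C ! a}})"
  proof -
    have eq: "block x i n = C \<longleftrightarrow> (\<forall>a<n. x (i + of_nat a) = C ! a)"
      if "C \<in> Q \<inter> words n" for x :: "'i \<Rightarrow> 'a" and C
      using that by (auto simp: block_def words_def list_eq_iff_nth_eq)
    have "block x i n \<in> Q \<longleftrightarrow> (\<exists>C\<in>Q \<inter> words n. block x i n = C)" for x :: "'i \<Rightarrow> 'a" by auto
    then have "block x i n \<in> Q \<longleftrightarrow> (\<exists>C\<in>Q \<inter> words n. \<forall>a<n. x (i + of_nat a) = C ! a)" for x :: "'i \<Rightarrow> 'a"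
      using eq by (metis (no_types, lifting))
    then show ?thesis by auto
  qed
  then show ?thesis by (simp only:) (intro open_UN open_INT ballI coordinate_vimage finite_lessThan)
qed

lemma closed_cyl: "closed (cyl i n Q)"
proof -
  have "cyl i n Q = X \<inter> - {x. block x i n \<in> - Q}" by (auto simp: cyl_def)
  then show ?thesis using closed_X open_block[of i n "- Q"] by (simp only:) (intro closed_Int closed_Compl)
qed

lemma compact_X: "compact X"
proof -
  have "compactin (product_topology (\<lambda>_::'i. euclidean :: 'a topology) UNIV) (PiE UNIV (\<lambda>_. UNIV))"
    by (subst compactin_PiE) (auto simp: finite_imp_compact)
  then have "compact (UNIV :: ('i \<Rightarrow> 'a) set)"
    by (simp add: euclidean_product_topology)
  then show ?thesis using closed_X compact_Int_closed by fastforce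
qed

text \<open>Cylinders are closed in the compact \<open>X\<close>, so the finite intersection
  property applies. This reduces continuity at the empty set, as Caratheodory's theorem asks for, to
  finite additivity.\<close>

lemma cylinders_compact:
  assumes A: "range A \<subseteq> cylinders" "decseq A" "(\<Inter>k. A k) = {}"
  shows "\<exists>k::nat. A k = {}"
proof (rule ccontr)
  assume ne: "\<not> ?thesis"
  have "X \<inter> \<Inter>(range A) \<noteq> {}"
  proof (rule compact_imp_fip[OF compact_X])
    fix T assume "T \<in> range A"
    then have "T \<in> cylinders" using A(1) by auto
    then show "closed T" by (auto simp: cylinders_def closed_cyl)
  next
    fix F assume F: "finite F" "F \<subseteq> range A"
    then obtain K where K: "finite K" "F = A ` K" by (meson finite_subset_image)
    have "A (Max (insert 0 K)) \<subseteq> A k" if "k \<in> K" for k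
      using A(2) K(1) that by (auto simp: decseq_def)
    moreover have "A (Max (insert 0 K)) \<subseteq> X" using A(1) cylinders_Pow by blast
    moreover have "A (Max (insert 0 K)) \<noteq> {}" using ne by auto
    ultimately show "X \<inter> \<Inter>F \<noteq> {}" unfolding K(2) by blast
  qed
  with A(3) show False by simp
qed

text \<open>A basic open set restricts finitely many coordinates, all inside one window, and there
  are only countably many pairs of a position and a word.\<close>

lemma open_cylinders:
  assumes U: "open U"
  shows "X \<inter> U \<in> sigma_sets X cylinders"
proof -
  define K where "K = {(i, C). cyl i (length C) {C} \<subseteq> U}"
  have "X \<inter> U = (\<Union>(i, C)\<in>K. cyl i (length C) {C})"
  proof
    show "(\<Union>(i, C)\<in>K. cyl i (length C) {C}) \<subseteq> X \<inter> U" by (auto simp: K_def cyl_def)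
    show "X \<inter> U \<subseteq> (\<Union>(i, C)\<in>K. cyl i (length C) {C})"
    proof
      fix x assume x: "x \<in> X \<inter> U"
      have "openin (product_topology (\<lambda>_::'i. euclidean :: 'a topology) UNIV) U"
        using U by (simp add: open_fun_def)
      then obtain V where V: "finite {i. V i \<noteq> UNIV}" "x \<in> PiE UNIV V" "PiE UNIV V \<subseteq> U"
        using x unfolding openin_product_topology_alt by auto
      have "\<forall>\<^sub>F k in sequentially. \<forall>i\<in>{i. V i \<noteq> UNIV}. \<exists>a. i = w k + of_nat a \<and> a + 1 \<le> wl k"
        using V(1) by (intro eventually_ball_finite ballI window)
      from eventually_happens'[OF sequentially_bot this] obtain k
        where k: "\<And>i. V i \<noteq> UNIV \<Longrightarrow> \<exists>a. i = w k + of_nat a \<and> a < wl k"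
        by (auto simp: Suc_le_eq)
      have "y \<in> U" if "block y (w k) (wl k) = block x (w k) (wl k)" for y
      proof -
        have "y i \<in> V i" for i
        proof (cases "V i = UNIV")
          case False
          then obtain a where "i = w k + of_nat a" "a < wl k" using k by blast
          then have "y i = x i" using that by (auto simp: block_eq_iff)
          then show ?thesis using V(2) by auto
        qed simp
        then show ?thesis using V(3) by auto
      qed
      then have "(w k, block x (w k) (wl k)) \<in> K" by (auto simp: K_def cyl_def)
      moreover have "x \<in> cyl (w k) (length (block x (w k) (wl k))) {block x (w k) (wl k)}"
        using x by (simp add: cyl_def)
      ultimately show "x \<in> (\<Union>(i, C)\<in>K. cyl i (length C) {C})" by blast
    qed
  qed
  also have "\<dots> \<in> sigma_sets X cylinders"
  proof -
    interpret sigma_algebra X "sigma_sets X cylinders" by (rule sigma_algebra_sigma_sets[OF cylinders_Pow])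
    show ?thesis
      by (rule countable_UN'') (auto intro!: sigma_sets.Basic cyl_in_cylinders simp: countableI_type)
  qed
  finally show ?thesis .
qed

lemma sets_X: "sets (restrict_space borel X) = sigma_sets X cylinders"
proof
  have "cyl i n Q \<in> sets (restrict_space borel X)" for i n Q
  proof -
    have "cyl i n Q = X \<inter> {x. block x i n \<in> Q}" by (auto simp: cyl_def)
    then show ?thesis using open_block[of i n Q] by (auto simp: sets_restrict_space)
  qed
  then have "cylinders \<subseteq> sets (restrict_space borel X)" by (auto simp: cylinders_def)
  from sets.sigma_sets_subset[OF this] show "sigma_sets X cylinders \<subseteq> sets (restrict_space borel X)"
    by (simp add: space_restrict_space)
  have "(\<lambda>x. x) \<in> borel_measurable (sigma X cylinders)"
    by (rule borel_measurableI)
      (use open_cylinders cylinders_Pow in \<open>simp add: space_measure_of_conv sets_measure_of Int_commute\<close>)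
  from measurable_sets[OF this] have "X \<inter> B \<in> sigma_sets X cylinders" if "B \<in> sets borel" for B
    using that cylinders_Pow by (simp add: space_measure_of_conv sets_measure_of Int_commute)
  then show "sets (restrict_space borel X) \<subseteq> sigma_sets X cylinders"
    by (auto simp: sets_restrict_space)
qed

text \<open>Defined from the set \<open>A\<close> itself, so that no representation of
  \<open>A\<close> as a cylinder has to be chosen; on cylinders the sequence is eventually
  constant.\<close>

definition cyl_content :: "('a list \<Rightarrow> real) \<Rightarrow> ('i \<Rightarrow> 'a) set \<Rightarrow> real" where
  "cyl_content p A = lim (\<lambda>k. \<Sum>C\<in>(\<lambda>x. block x (w k) (wl k)) ` A. p C)"

text \<open>The words over \<open>Q\<close> that no point of \<open>X\<close> shows in the window
  contribute nothing: by \<open>realize\<close> they are outside the language, where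
  \<open>p\<close> vanishes.\<close>

lemma sum_window_cyl:
  assumes p: "invariant_weight (lang X) p" and Q: "Q \<subseteq> words n"
    and a: "i = w k + of_nat a" "a + n \<le> wl k"
  shows "(\<Sum>C\<in>(\<lambda>x. block x (w k) (wl k)) ` cyl i n Q. p C) = (\<Sum>C\<in>Q. p C)"
proof -
  have "(\<Sum>C\<in>(\<lambda>x. block x (w k) (wl k)) ` cyl i n Q. p C) = (\<Sum>B\<in>{B\<in>words (wl k). take n (drop a B) \<in> Q}. p B)"
  proof (rule sum.mono_neutral_left)
    show "(\<lambda>x. block x (w k) (wl k)) ` cyl i n Q \<subseteq> {B\<in>words (wl k). take n (drop a B) \<in> Q}"
      using a by (auto simp: cyl_def take_drop_block)
    show "\<forall>B\<in>{B\<in>words (wl k). take n (drop a B) \<in> Q} - (\<lambda>x. block x (w k) (wl k)) ` cyl i n Q. p B = 0"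
    proof (rule ballI, rule ccontr)
      fix B assume B: "B \<in> {B\<in>words (wl k). take n (drop a B) \<in> Q} - (\<lambda>x. block x (w k) (wl k)) ` cyl i n Q"
        and "p B \<noteq> 0"
      then have "B \<in> lang X" using invariant_weightD(4)[OF p] by blast
      then obtain x j l where x: "x \<in> X" "B = block x j l" by (auto simp: lang_def)
      have l: "l = wl k" using B x(2) by (simp add: words_def)
      obtain y where y: "y \<in> X" "\<And>m. y (w k + of_nat m) = x (j + of_nat m)"
        using realize[OF x(1), of k j] by auto
      have By: "B = block y (w k) (wl k)" unfolding x(2) l by (simp add: block_eq_iff y(2))
      have "y \<in> cyl i n Q" using B y(1) a unfolding By by (simp add: cyl_def take_drop_block)
      then show False using B By by blast
    qed
  qed simp
  also have "\<dots> = (\<Sum>C\<in>Q. p C)" by (rule invariant_weight_window[OF p Q a(2)])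
  finally show ?thesis .
qed

lemma cyl_content_cyl:
  assumes p: "invariant_weight (lang X) p" and Q: "Q \<subseteq> words n"
  shows "cyl_content p (cyl i n Q) = (\<Sum>C\<in>Q. p C)"
proof -
  have "\<forall>\<^sub>F k in sequentially. (\<Sum>C\<in>(\<lambda>x. block x (w k) (wl k)) ` cyl i n Q. p C) = (\<Sum>C\<in>Q. p C)"
    using window[of i n] by eventually_elim (use sum_window_cyl[OF p Q] in blast)
  then show ?thesis unfolding cyl_content_def by (intro limI tendsto_eventually)
qed

lemma cyl_content_Un:
  assumes p: "invariant_weight (lang X) p" and A: "A \<in> cylinders" and B: "B \<in> cylinders" and "A \<inter> B = {}"
  shows "cyl_content p (A \<union> B) = cyl_content p A + cyl_content p B"
proof -
  from A B obtain k Q R where k: "A = cyl (w k) (wl k) Q" "B = cyl (w k) (wl k) R" "Q \<subseteq> words (wl k)"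
    by (rule cylinders_window2)
  \<comment> \<open>\<open>Q\<close> and \<open>R\<close> may overlap in words that never occur in
    \<open>X\<close>; the words actually seen are disjoint.\<close>
  define Q' where "Q' = (\<lambda>x. block x (w k) (wl k)) ` A"
  define R' where "R' = (\<lambda>x. block x (w k) (wl k)) ` B"
  have QR: "Q' \<subseteq> words (wl k)" "R' \<subseteq> words (wl k)" by (auto simp: Q'_def R'_def)
  have AB: "A = cyl (w k) (wl k) Q'" "B = cyl (w k) (wl k) R'" by (auto simp: k cyl_def Q'_def R'_def)
  have "Q' \<inter> R' = {}" using assms(4) unfolding Q'_def R'_def k by (auto simp: cyl_def)
  moreover have "A \<union> B = cyl (w k) (wl k) (Q' \<union> R')" unfolding AB by (auto simp: cyl_def)
  moreover have "cyl_content p A = (\<Sum>C\<in>Q'. p C)" "cyl_content p B = (\<Sum>C\<in>R'. p C)"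
    unfolding AB by (intro cyl_content_cyl p QR)+
  ultimately show ?thesis
    using cyl_content_cyl[OF p, of "Q' \<union> R'" "wl k" "w k"] QR
    by (simp add: sum.union_disjoint finite_subset[OF _ finite_words])
qed

lemma cyl_content_nonneg:
  assumes p: "invariant_weight (lang X) p" and A: "A \<in> cylinders"
  shows "0 \<le> cyl_content p A"
  using A by (auto simp: cylinders_def cyl_content_cyl[OF p] intro!: sum_nonneg invariant_weightD(1)[OF p])

lemma measure_exists:
  assumes p: "invariant_weight (lang X) p"
  obtains \<nu> where "sets \<nu> = sets (restrict_space borel X)"
    "\<And>i n Q. Q \<subseteq> words n \<Longrightarrow> emeasure \<nu> (cyl i n Q) = ennreal (\<Sum>C\<in>Q. p C)"
proof -
  interpret algebra X cylinders by (rule algebra_cylinders)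
  have empty: "cyl_content p {} = 0" using cyl_content_cyl[OF p, of "{}" 0 0] by (simp add: cyl_def)
  have "\<exists>\<mu>. (\<forall>A\<in>cylinders. \<mu> A = ennreal (cyl_content p A)) \<and> measure_space X (sigma_sets X cylinders) \<mu>"
  proof (rule caratheodory_empty_continuous)
    show "positive cylinders (\<lambda>A. ennreal (cyl_content p A))" by (simp add: positive_def empty)
    show "additive cylinders (\<lambda>A. ennreal (cyl_content p A))"
      by (auto simp: additive_def cyl_content_Un[OF p] cyl_content_nonneg[OF p] simp flip: ennreal_plus)
    fix A :: "nat \<Rightarrow> ('i \<Rightarrow> 'a) set"
    assume A: "range A \<subseteq> cylinders" "decseq A" "(\<Inter>i. A i) = {}"
    then obtain k where "A k = {}" using cylinders_compact by blast
    then have "A j = {}" if "k \<le> j" for j using A(2) that by (auto simp: decseq_def)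
    then have "\<forall>\<^sub>F j in sequentially. ennreal (cyl_content p (A j)) = 0"
      by (intro eventually_sequentiallyI[of k]) (simp add: empty)
    then show "(\<lambda>j. ennreal (cyl_content p (A j))) \<longlonglongrightarrow> 0" by (rule tendsto_eventually)
  qed simp
  then obtain \<mu> where \<mu>: "\<And>A. A \<in> cylinders \<Longrightarrow> \<mu> A = ennreal (cyl_content p A)"
    and ms: "measure_space X (sigma_sets X cylinders) \<mu>" by blast
  define \<nu> where "\<nu> = measure_of X (sigma_sets X cylinders) \<mu>"
  have sub: "sigma_sets X cylinders \<subseteq> Pow X" by (rule sigma_sets_into_sp[THEN PowI, THEN subsetI]) (rule cylinders_Pow)
  show ?thesis
  proof
    show "sets \<nu> = sets (restrict_space borel X)"
      unfolding \<nu>_def sets_X using sub by (simp add: sigma_sets_sigma_sets_eq cylinders_Pow)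
    fix i n and Q :: "'a list set" assume Q: "Q \<subseteq> words n"
    have "emeasure \<nu> (cyl i n Q) = \<mu> (cyl i n Q)"
      unfolding \<nu>_def using ms
      by (intro emeasure_measure_of_sigma) (auto simp: measure_space_def intro: cyl_in_cylinders)
    then show "emeasure \<nu> (cyl i n Q) = ennreal (\<Sum>C\<in>Q. p C)"
      by (simp add: \<mu> cyl_in_cylinders cyl_content_cyl[OF p Q])
  qed
qed

end

section \<open>Invariance and ergodicity of the extended measure\<close>

lemma block_Suc_snoc: "block x i (Suc n) = block x i n @ [x (i + of_nat n)]"
  by (simp add: block_def)

lemma block_Suc_Cons: "block x i (Suc n) = x i # block x (i + 1) n"
  by (rule nth_equalityI) (auto simp: block_def nth_Cons add_ac simp del: upt_Suc split: nat.split)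

context windowed_subshift
begin

lemma shift_vimage_cyl: "shift -` cyl i n Q \<inter> X = cyl (i + 1) n Q"
  using shift_in by (auto simp: cyl_def block_shift)

lemma measure_eqI_cylinders:
  assumes "sets M = sets (restrict_space borel X)" "sets N = sets (restrict_space borel X)"
    and "\<And>i n Q. Q \<subseteq> words n \<Longrightarrow> emeasure M (cyl i n Q) = emeasure N (cyl i n Q)"
    and "emeasure M X \<noteq> \<infinity>"
  shows "M = N"
proof (rule measure_eqI_generator_eq[OF Int_stable_cylinders cylinders_Pow])
  show "emeasure M A = emeasure N A" if "A \<in> cylinders" for A
    using that assms(3) by (auto simp: cylinders_def)
  show "range (\<lambda>_. X) \<subseteq> cylinders" using X_in_cylinders by auto
qed (use assms sets_X in auto)

text \<open>As \<open>T\<close> equals its preimage, the preimage of \<open>T\<close> intersected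
  with a cylinder is \<open>T\<close> intersected with the cylinder moved by 1. Applied to an
  invariant set and to its complement, this splits a weight.\<close>

lemma invariant_part_weight:
  assumes \<nu>: "\<nu> \<in> invariant_measures X" and T: "T \<in> sets \<nu>" "shift -` T \<inter> X = T"
  shows "invariant_weight (lang X) (\<lambda>C. measure \<nu> (T \<inter> cyl 0 (length C) {C}))" (is ?weight)
    and "measure \<nu> (T \<inter> cyl i n Q) = measure \<nu> (T \<inter> cyl 0 n Q)" (is ?translate)
proof -
  have sets: "sets \<nu> = sets (restrict_space borel X)" and one: "emeasure \<nu> (space \<nu>) = 1"
    and inv: "\<And>S. S \<in> sets \<nu> \<Longrightarrow> emeasure \<nu> (shift -` S \<inter> X) = emeasure \<nu> S"
    using \<nu> by (auto simp: invariant_measures_def prob_measures_def)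
  interpret finite_measure \<nu> by (rule finite_measureI) (simp add: one)
  have cyl_sets: "cyl i n Q \<in> sets \<nu>" for i n Q
    unfolding sets sets_X by (intro sigma_sets.Basic cyl_in_cylinders)
  have step: "measure \<nu> (T \<inter> cyl (i + 1) n Q) = measure \<nu> (T \<inter> cyl i n Q)" for i n Q
  proof -
    have "shift -` (T \<inter> cyl i n Q) \<inter> X = T \<inter> cyl (i + 1) n Q"
      using T(2) shift_vimage_cyl[of i n Q] by blast
    then show ?thesis using inv[of "T \<inter> cyl i n Q"] T(1) cyl_sets by (simp add: measure_def)
  qed
  have steps: "measure \<nu> (T \<inter> cyl (i + of_nat a) n Q) = measure \<nu> (T \<inter> cyl i n Q)" for i n Q a
  proof (induction a)
    case (Suc a)
    have "i + of_nat (Suc a) = (i + of_nat a) + 1" by (simp add: add_ac)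
    then show ?case using step[of "i + of_nat a"] Suc by metis
  qed simp
  \<comment> \<open>\<open>steps\<close> only moves to the right, so both positions are reached from
    the start of a window lying to the left of both.\<close>
  have trans: "measure \<nu> (T \<inter> cyl i n Q) = measure \<nu> (T \<inter> cyl j n Q)" for i j n Q
  proof -
    have "\<forall>\<^sub>F k in sequentially. (\<exists>a. i = w k + of_nat a \<and> a + 0 \<le> wl k) \<and> (\<exists>b. j = w k + of_nat b \<and> b + 0 \<le> wl k)"
      by (intro eventually_conj window)
    from eventually_happens'[OF sequentially_bot this] obtain k a b
      where "i = w k + of_nat a" "j = w k + of_nat b" by blast
    then show ?thesis by (simp add: steps)
  qed
  then show ?translate .
  have union: "(\<Sum>a\<in>UNIV. measure \<nu> (T \<inter> cyl 0 n {D a})) = measure \<nu> (T \<inter> cyl i m Q)"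
    if "inj D" "(\<Union>a. cyl 0 n {D a}) = cyl i m Q" for D :: "'a \<Rightarrow> 'a list" and n i m Q
  proof -
    have "measure \<nu> (\<Union>a\<in>UNIV. T \<inter> cyl 0 n {D a}) = (\<Sum>a\<in>UNIV. measure \<nu> (T \<inter> cyl 0 n {D a}))"
    proof (rule finite_measure_finite_Union)
      show "disjoint_family_on (\<lambda>a. T \<inter> cyl 0 n {D a}) UNIV"
        using that(1) by (auto simp: disjoint_family_on_def cyl_def inj_eq)
    qed (use T(1) cyl_sets in auto)
    moreover have "(\<Union>a\<in>UNIV. T \<inter> cyl 0 n {D a}) = T \<inter> cyl i m Q" using that(2) by blast
    ultimately show ?thesis by simp
  qed
  have "(\<Sum>a\<in>UNIV. measure \<nu> (T \<inter> cyl 0 (Suc (length C)) {C @ [a]})) = measure \<nu> (T \<inter> cyl 0 (length C) {C})" for C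
    by (rule union) (auto simp: inj_def cyl_def block_Suc_snoc)
  moreover have "(\<Sum>a\<in>UNIV. measure \<nu> (T \<inter> cyl 0 (Suc (length C)) {a # C})) = measure \<nu> (T \<inter> cyl (0 + 1) (length C) {C})" for C
    by (rule union) (auto simp: inj_def cyl_def block_Suc_Cons)
  moreover have "cyl 0 (length C) {C} = {}" if "C \<notin> lang X" for C
  proof -
    have "block x 0 (length C) \<noteq> C" if "x \<in> X" for x
      using that \<open>C \<notin> lang X\<close> unfolding lang_def by (metis (mono_tags, lifting) mem_Collect_eq)
    then show ?thesis by (auto simp: cyl_def)
  qed
  ultimately show ?weight using step[of 0] by (simp add: invariant_weight_def)
qed

text \<open>An invariant set \<open>S\<close> splits \<open>p\<close> into two invariant weights.
  Extremality makes \<open>S\<close> independent of every cylinder, hence of every Borel set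
  including \<open>S\<close> itself, so its measure equals its square.\<close>

lemma ergodic_measure_exists:
  assumes ext: "extreme_weight (lang X) p"
  obtains \<nu> where "\<nu> \<in> ergodic_measures X" "\<And>C. val (Inr \<nu>) C = p C"
proof -
  have p: "invariant_weight (lang X) p" "p [] = 1" using ext by (auto simp: extreme_weight_def)
  from measure_exists[OF p(1)] obtain \<nu> where sets: "sets \<nu> = sets (restrict_space borel X)"
    and em: "\<And>i n Q. Q \<subseteq> words n \<Longrightarrow> emeasure \<nu> (cyl i n Q) = ennreal (\<Sum>C\<in>Q. p C)" by blast
  have space: "space \<nu> = X" using sets_eq_imp_space_eq[OF sets] by (simp add: space_restrict_space)
  have cyl_sets: "cyl i n Q \<in> sets \<nu>" for i n Q
    unfolding sets sets_X by (intro sigma_sets.Basic cyl_in_cylinders)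
  have "X = cyl 0 0 {[]}" by (auto simp: cyl_def block_def)
  then have one: "emeasure \<nu> X = 1" using em[of "{[]}" 0 0] p(2) by simp
  interpret finite_measure \<nu> by (rule finite_measureI) (simp add: one space)
  have meas: "measure \<nu> (cyl i n Q) = (\<Sum>C\<in>Q. p C)" if "Q \<subseteq> words n" for i n Q
    using em[OF that, of i] by (simp add: measure_def sum_nonneg invariant_weightD(1)[OF p(1)])
  have shift: "shift \<in> measurable \<nu> \<nu>"
  proof (rule measurable_sigma_sets[OF sets[unfolded sets_X] cylinders_Pow])
    show "shift \<in> space \<nu> \<rightarrow> X" using shift_in by (auto simp: space)
    show "shift -` A \<inter> space \<nu> \<in> sets \<nu>" if "A \<in> cylinders" for A
      using that by (auto simp: cylinders_def space shift_vimage_cyl cyl_sets)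
  qed
  have "distr \<nu> \<nu> shift = \<nu>"
  proof (rule measure_eqI_cylinders)
    show "emeasure (distr \<nu> \<nu> shift) (cyl i n Q) = emeasure \<nu> (cyl i n Q)" if "Q \<subseteq> words n" for i n Q
      by (simp add: emeasure_distr[OF shift] cyl_sets space shift_vimage_cyl em[OF that])
    show "emeasure (distr \<nu> \<nu> shift) X \<noteq> \<infinity>"
      using sets.top[of \<nu>] by (simp add: emeasure_distr[OF shift] space)
  qed (use sets in auto)
  then have "emeasure \<nu> (shift -` S \<inter> X) = emeasure \<nu> S" if "S \<in> sets \<nu>" for S
    using emeasure_distr[OF shift that] by (simp add: space)
  then have inv: "\<nu> \<in> invariant_measures X"
    by (simp add: invariant_measures_def prob_measures_def sets space one)
  have erg: "emeasure \<nu> S = 0 \<or> emeasure \<nu> S = 1" if S: "S \<in> sets \<nu>" "shift -` S \<inter> X = S" for S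
  proof -
    define q where "q C = measure \<nu> (S \<inter> cyl 0 (length C) {C})" for C
    define r where "r C = measure \<nu> ((X - S) \<inter> cyl 0 (length C) {C})" for C
    have S': "X - S \<in> sets \<nu>" "shift -` (X - S) \<inter> X = X - S"
      using S sets.compl_sets[of S \<nu>] shift_in by (auto simp: space)
    have SX: "S \<subseteq> X" using S(2) by auto
    have qr: "p C = q C + r C" for C
    proof -
      have "measure \<nu> (cyl 0 (length C) {C}) = q C + r C"
      proof -
        have "cyl 0 (length C) {C} = (S \<inter> cyl 0 (length C) {C}) \<union> ((X - S) \<inter> cyl 0 (length C) {C})"
          using cyl_subset by blast
        moreover have "measure \<nu> ((S \<inter> cyl 0 (length C) {C}) \<union> ((X - S) \<inter> cyl 0 (length C) {C})) = q C + r C"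
          unfolding q_def r_def by (rule finite_measure_Union) (use S(1) S'(1) cyl_sets in auto)
        ultimately show ?thesis by metis
      qed
      then show ?thesis by (simp add: meas words_def)
    qed
    have q_mult: "q C = q [] * p C" for C
      by (rule extreme_weightD[OF ext invariant_part_weight(1)[OF inv S, folded q_def]
          invariant_part_weight(1)[OF inv S', folded r_def] qr])
    have "S \<inter> cyl 0 0 {[]} = S" using \<open>X = cyl 0 0 {[]}\<close> SX by auto
    then have q_Nil: "q [] = measure \<nu> S" by (simp add: q_def)
    \<comment> \<open>Independence of \<open>S\<close> from all measurable sets, written as an
      equality of measures so that it can be checked on cylinders.\<close>
    have "density \<nu> (indicator S) = scale_measure (emeasure \<nu> S) \<nu>"
    proof (rule measure_eqI_cylinders)
      fix i n and Q :: "'a list set" assume Q: "Q \<subseteq> words n"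
      have finQ: "finite Q" by (rule finite_subset[OF Q]) simp
      have "measure \<nu> (S \<inter> cyl i n Q) = measure \<nu> (\<Union>C\<in>Q. S \<inter> cyl i n {C})"
        by (rule arg_cong[of _ _ "measure \<nu>"]) (auto simp: cyl_def)
      also have "\<dots> = (\<Sum>C\<in>Q. measure \<nu> (S \<inter> cyl i n {C}))"
      proof (rule finite_measure_finite_Union)
        show "disjoint_family_on (\<lambda>C. S \<inter> cyl i n {C}) Q"
          by (auto simp: disjoint_family_on_def cyl_def)
      qed (use finQ S(1) cyl_sets in auto)
      also have "\<dots> = (\<Sum>C\<in>Q. q C)"
        using Q by (intro sum.cong refl) (auto simp: q_def words_def invariant_part_weight(2)[OF inv S, of i])
      also have "\<dots> = measure \<nu> S * measure \<nu> (cyl i n Q)"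
        by (subst q_mult) (simp add: q_Nil meas[OF Q] flip: sum_distrib_left)
      finally show "emeasure (density \<nu> (indicator S)) (cyl i n Q)
          = emeasure (scale_measure (emeasure \<nu> S) \<nu>) (cyl i n Q)"
        by (simp add: emeasure_restricted[OF S(1) cyl_sets] emeasure_eq_measure ennreal_mult)
    qed (use sets S(1) sets.top[of \<nu>] in \<open>auto simp: emeasure_restricted space\<close>)
    then have "emeasure (density \<nu> (indicator S)) S = emeasure (scale_measure (emeasure \<nu> S) \<nu>) S" by simp
    then have "emeasure \<nu> S = emeasure \<nu> S * emeasure \<nu> S" by (simp add: emeasure_restricted[OF S(1) S(1)])
    then have "measure \<nu> S = measure \<nu> S * measure \<nu> S"
      by (simp add: emeasure_eq_measure flip: ennreal_mult)
    then have "measure \<nu> S = 0 \<or> measure \<nu> S = 1" by auto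
    then show ?thesis by (auto simp: emeasure_eq_measure)
  qed
  show ?thesis
  proof
    show "\<nu> \<in> ergodic_measures X" using inv erg by (auto simp: ergodic_measures_def)
    fix C
    have "{x \<in> space \<nu>. block x 0 (length C) = C} = cyl 0 (length C) {C}" by (auto simp: space cyl_def)
    then show "val (Inr \<nu>) C = p C" by (simp add: meas words_def)
  qed
qed

end

text \<open>Here \<open>v\<close> will be the values of an ergodic measure. Finitely many frequency
  conditions suffice for small \<open>dstar\<close>, since each inner sum is at most 2 and the tail
  of the series is geometric.\<close>

lemma dstar_series_small:
  fixes v :: "'a::finite list \<Rightarrow> real"
  assumes v: "\<And>C. 0 \<le> v C" "\<And>n. (\<Sum>C\<in>words n. v C) = 1" and e: "0 < e"
  obtains \<epsilon> F where "0 < \<epsilon>" "finite F" "\<And>B. (\<And>C. C \<in> F \<Longrightarrow> \<bar>freq B C - v C\<bar> < \<epsilon>) \<Longrightarrow>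
     (\<Sum>l. (1/2) ^ Suc l * (\<Sum>C | length C = Suc l. \<bar>v C - freq B C\<bar>)) < e"
proof -
  obtain l0 where "(1/2 :: real) ^ l0 < e / 4"
    using real_arch_pow_inv[of "e / 4" "1/2"] e by auto
  then have l0: "2 * (1/2 :: real) ^ l0 < e / 2" by simp
  define F :: "'a list set" where "F = (\<Union>l<l0. words (Suc l))"
  \<comment> \<open>Each inner sum with \<open>l < l0\<close> has at most \<open>card F\<close>
    terms and so is at most \<open>e / 2\<close>; the tail from \<open>l0\<close> on takes the other
    half.\<close>
  define \<epsilon> where "\<epsilon> = e / (2 * (card F + 1))"
  have finF: "finite F" by (simp add: F_def)
  show ?thesis
  proof (rule that[OF _ finF])
    show "0 < \<epsilon>" using e by (simp add: \<epsilon>_def)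
    fix B assume B: "\<bar>freq B C - v C\<bar> < \<epsilon>" if "C \<in> F" for C
    define D where "D l = (\<Sum>C\<in>words (Suc l). \<bar>v C - freq B C\<bar>)" for l
    have D0: "0 \<le> D l" for l by (simp add: D_def sum_nonneg)
    have D2: "D l \<le> 2" for l
    proof -
      have "D l \<le> (\<Sum>C\<in>words (Suc l). v C + freq B C)"
        unfolding D_def
      proof (rule sum_mono)
        fix C show "\<bar>v C - freq B C\<bar> \<le> v C + freq B C"
          using v(1)[of C] freq_nonneg[of B C] by linarith
      qed
      also have "\<dots> \<le> 1 + 1"
        unfolding sum.distrib v(2) using sum_freq_le_1[of "Suc l" B] by simp
      finally show ?thesis by simp
    qed
    have Dsmall: "D l \<le> e / 2" if "l < l0" for l
    proof -
      have sub: "words (Suc l) \<subseteq> F" using that by (auto simp: F_def)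
      have "D l \<le> (\<Sum>C\<in>(words (Suc l) :: 'a list set). \<epsilon>)"
        unfolding D_def
      proof (rule sum_mono)
        fix C :: "'a list" assume "C \<in> words (Suc l)"
        then have "\<bar>freq B C - v C\<bar> < \<epsilon>" using B sub by blast
        then show "\<bar>v C - freq B C\<bar> \<le> \<epsilon>" by linarith
      qed
      also have "\<dots> \<le> card F * \<epsilon>"
        using card_mono[OF finF sub] \<open>0 < \<epsilon>\<close> by (simp add: mult_right_mono)
      also have "\<dots> \<le> (card F + 1) * \<epsilon>" using \<open>0 < \<epsilon>\<close> by simp
      also have "\<dots> = e / 2" by (simp add: \<epsilon>_def field_simps)
      finally show ?thesis .
    qed
    have geo: "(\<lambda>l. (1/2 :: real) ^ Suc (l + k) * 2) sums (2 * (1/2) ^ k)" for k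
    proof -
      have "(\<lambda>l. (1/2 :: real) ^ k * (1/2) ^ l) sums ((1/2) ^ k * 2)"
        using geometric_sums[of "1/2 :: real"] by (intro sums_mult) simp
      then show ?thesis by (simp add: power_add mult_ac)
    qed
    have term_le: "(1/2) ^ Suc l * D l \<le> (1/2) ^ Suc l * 2" for l
      by (intro mult_left_mono D2) simp
    have summ: "summable (\<lambda>l. (1/2) ^ Suc l * D l)"
      by (rule summable_comparison_test'[OF sums_summable[OF geo[of 0]], of 0])
        (use term_le D0 in \<open>simp add: abs_mult\<close>)
    have "(\<Sum>l. (1/2) ^ Suc l * D l)
        = (\<Sum>l. (1/2) ^ Suc (l + l0) * D (l + l0)) + (\<Sum>l<l0. (1/2) ^ Suc l * D l)"
      by (rule suminf_split_initial_segment[OF summ])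
    also have "(\<Sum>l. (1/2) ^ Suc (l + l0) * D (l + l0)) \<le> (\<Sum>l. (1/2) ^ Suc (l + l0) * 2)"
      using summ geo[of l0]
      by (intro suminf_le term_le summable_ignore_initial_segment[OF summ]) (auto simp: sums_iff)
    also have "(\<Sum>l. (1/2) ^ Suc (l + l0) * 2) = 2 * (1/2 :: real) ^ l0"
      using geo[of l0] by (simp add: sums_iff)
    also have "(\<Sum>l<l0. (1/2) ^ Suc l * D l) \<le> (\<Sum>l<l0. (1/2) ^ Suc l * (e / 2))"
      by (intro sum_mono mult_left_mono Dsmall) auto
    also have "\<dots> = (\<Sum>l<l0. (1/2) ^ Suc l) * (e / 2)" by (simp only: sum_distrib_right)
    also have "(\<Sum>l<l0. (1/2 :: real) ^ Suc l) = 1 - (1/2) ^ l0" by (induction l0) auto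
    also have "2 * (1/2) ^ l0 + (1 - (1/2) ^ l0) * (e / 2) < e"
    proof -
      have "(1 - (1/2) ^ l0) * (e / 2) \<le> 1 * (e / 2)" using e by (intro mult_right_mono) auto
      then show ?thesis using l0 by linarith
    qed
    finally show "(\<Sum>l. (1/2) ^ Suc l * (\<Sum>C | length C = Suc l. \<bar>v C - freq B C\<bar>)) < e"
      by (simp add: D_def words_def)
  qed
qed

section \<open>Sparse sets of coordinates\<close>

definition hits :: "'i::linordered_semidom set \<Rightarrow> 'i \<Rightarrow> nat \<Rightarrow> nat" where
  "hits E i N = card (E \<inter> {i..<i + of_nat N})"

text \<open>Upper Banach density 0, without suprema and infima.\<close>

definition sparse :: "'i::linordered_semidom set \<Rightarrow> bool" where
  "sparse E \<longleftrightarrow> (\<forall>\<delta>>0. \<exists>N\<ge>1. \<forall>i. real (hits E i N) \<le> \<delta> * real N)"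

text \<open>The failing \<delta> works for every length \<open>N\<close>, which gives one dense
  interval of each length.\<close>

lemma not_sparseE:
  assumes "\<not> sparse E"
  obtains \<delta> f where "0 < \<delta>" "\<And>N. N \<ge> 1 \<Longrightarrow> \<delta> * real N < real (hits E (f N) N)"
proof -
  from assms obtain \<delta> where \<delta>: "0 < \<delta>" "\<And>N. N \<ge> 1 \<Longrightarrow> \<exists>i. \<not> real (hits E i N) \<le> \<delta> * real N"
    unfolding sparse_def by blast
  define f where "f N = (SOME i. \<not> real (hits E i N) \<le> \<delta> * real N)" for N
  have "\<not> real (hits E (f N) N) \<le> \<delta> * real N" if "N \<ge> 1" for N
    unfolding f_def by (rule someI_ex[OF \<delta>(2)[OF that]])
  then show ?thesis by (intro that[OF \<delta>(1)]) (simp add: not_le)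
qed

lemma interval_eq_image:
  fixes i :: "'i::discrete_linordered_semidom"
  shows "{i..<i + of_nat N} = (\<lambda>j. i + of_nat j) ` {..<N}"
proof (induction N)
  case (Suc N)
  have "x < i + of_nat (Suc N) \<longleftrightarrow> x \<le> i + of_nat N" for x
  proof -
    have "i + of_nat (Suc N) = (i + of_nat N) + 1" by (simp add: ac_simps)
    then show ?thesis by (simp only: less_iff_succ_less_eq add_le_cancel_right)
  qed
  moreover have "i \<le> i + of_nat N" by simp
  ultimately have "{i..<i + of_nat (Suc N)} = insert (i + of_nat N) {i..<i + of_nat N}"
    by (intro set_eqI) (simp only: atLeastLessThan_iff insert_iff, metis order_le_less)
  then show ?case by (simp add: Suc lessThan_Suc)
qed simp

lemma finite_interval [simp]: "finite {i..<i + of_nat N :: 'i::discrete_linordered_semidom}"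
  by (simp add: interval_eq_image)

lemma hits_eq:
  fixes i :: "'i::discrete_linordered_semidom"
  shows "hits E i N = card {j. j < N \<and> i + of_nat j \<in> E}"
proof -
  have "E \<inter> {i..<i + of_nat N} = (\<lambda>j. i + of_nat j) ` {j. j < N \<and> i + of_nat j \<in> E}"
    by (auto simp: interval_eq_image)
  then show ?thesis by (simp add: hits_def card_image inj_on_def)
qed

lemma hits_le: "hits E i N \<le> N"
  for i :: "'i::discrete_linordered_semidom"
proof -
  have "card {j. j < N \<and> i + of_nat j \<in> E} \<le> card {..<N}" by (intro card_mono) auto
  then show ?thesis by (simp add: hits_eq)
qed

lemma hits_add:
  fixes i :: "'i::discrete_linordered_semidom"
  shows "hits E i (M + N) = hits E i M + hits E (i + of_nat M) N"
proof -
  have "E \<inter> {i..<i + of_nat (M + N)}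
      = (E \<inter> {i..<i + of_nat M}) \<union> (E \<inter> {i + of_nat M..<i + of_nat M + of_nat N})"
    by (subst ivl_disj_un_two(3)[symmetric, of i "i + of_nat M"]) (auto simp: add.assoc)
  moreover have "(E \<inter> {i..<i + of_nat M}) \<inter> (E \<inter> {i + of_nat M..<i + of_nat M + of_nat N}) = {}" by auto
  ultimately show ?thesis unfolding hits_def by (simp add: card_Un_disjoint)
qed

lemma hits_mult:
  fixes i :: "'i::discrete_linordered_semidom"
  shows "hits E i (M * N) = (\<Sum>k<M. hits E (i + of_nat (k * N)) N)"
proof (induction M)
  case (Suc M)
  have "hits E i (Suc M * N) = hits E i (M * N + N)" by (simp add: add.commute)
  also have "\<dots> = hits E i (M * N) + hits E (i + of_nat (M * N)) N" by (rule hits_add)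
  finally show ?case using Suc by simp
qed (simp add: hits_def)

text \<open>Passing to multiples lets two sparse sets share one interval length.\<close>

lemma hits_mult_le:
  fixes i :: "'i::discrete_linordered_semidom"
  assumes "\<And>i. real (hits E i N) \<le> \<delta> * real N"
  shows "real (hits E i (M * N)) \<le> \<delta> * real (M * N)"
proof -
  have "real (hits E i (M * N)) = (\<Sum>k<M. real (hits E (i + of_nat (k * N)) N))"
    by (simp add: hits_mult)
  also have "\<dots> \<le> (\<Sum>k<M. \<delta> * real N)" by (intro sum_mono assms)
  finally show ?thesis by (simp add: mult_ac)
qed

lemma sparse_subset:
  fixes E :: "'i::discrete_linordered_semidom set"
  assumes "sparse E" "D \<subseteq> E"
  shows "sparse D"
proof -
  have "hits D i N \<le> hits E i N" for i N
    unfolding hits_def by (intro card_mono) (use assms(2) in auto)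
  then have le: "real (hits D i N) \<le> real (hits E i N)" for i N by simp
  show ?thesis
    unfolding sparse_def
  proof (intro allI impI)
    fix \<delta> :: real assume "0 < \<delta>"
    from assms(1)[unfolded sparse_def, rule_format, OF this]
    obtain N where "N \<ge> 1" "\<And>i. real (hits E i N) \<le> \<delta> * real N" by auto
    with order_trans[OF le] show "\<exists>N\<ge>1. \<forall>i. real (hits D i N) \<le> \<delta> * real N" by blast
  qed
qed

lemma sparse_Un:
  fixes D E :: "'i::discrete_linordered_semidom set"
  assumes D: "sparse D" and E: "sparse E"
  shows "sparse (D \<union> E)"
  unfolding sparse_def
proof (intro allI impI)
  fix \<delta> :: real assume "0 < \<delta>"
  then have "0 < \<delta> / 2" by simp
  from D[unfolded sparse_def, rule_format, OF this]
  obtain M where M: "M \<ge> 1" "\<And>i. real (hits D i M) \<le> \<delta> / 2 * real M" by auto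
  from E[unfolded sparse_def, rule_format, OF \<open>0 < \<delta> / 2\<close>]
  obtain N where N: "N \<ge> 1" "\<And>i. real (hits E i N) \<le> \<delta> / 2 * real N" by auto
  have "real (hits (D \<union> E) i (M * N)) \<le> \<delta> * real (M * N)" for i
  proof -
    have "hits (D \<union> E) i (M * N) \<le> hits D i (N * M) + hits E i (M * N)"
      unfolding hits_def Int_Un_distrib2 by (simp add: mult.commute card_Un_le)
    then have "real (hits (D \<union> E) i (M * N)) \<le> real (hits D i (N * M)) + real (hits E i (M * N))"
      by (simp flip: of_nat_add)
    also have "\<dots> \<le> \<delta> / 2 * real (N * M) + \<delta> / 2 * real (M * N)"
      by (intro add_mono hits_mult_le M N)
    finally show ?thesis by (simp add: field_simps)
  qed
  then show "\<exists>K\<ge>1. \<forall>i. real (hits (D \<union> E) i K) \<le> \<delta> * real K"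
    using M(1) N(1) by (intro exI[of _ "M * N"]) auto
qed

text \<open>If every interval of length \<open>N\<close> were hit, the density would be at least
  \<open>1 / N\<close>; counting hits in an interval of length \<open>N * M\<close> in two ways
  contradicts the bound \<open>1 / (2 * N)\<close>. This settles the lower Banach density.\<close>

lemma sparse_gap:
  fixes E :: "'i::discrete_linordered_semidom set"
  assumes E: "sparse E" and N: "N \<ge> 1"
  shows "\<exists>i. hits E i N = 0"
proof (rule ccontr)
  assume "\<not> ?thesis"
  then have pos: "1 \<le> hits E i N" for i by (simp add: Suc_le_eq)
  have "0 < 1 / (2 * real N)" using N by simp
  from E[unfolded sparse_def, rule_format, OF this]
  obtain M where M: "M \<ge> 1" "\<And>i. real (hits E i M) \<le> 1 / (2 * real N) * real M" by auto
  have "real M = (\<Sum>k<M. 1)" by simp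
  also have "\<dots> \<le> (\<Sum>k<M. real (hits E (0 + of_nat (k * N)) N))"
    by (intro sum_mono) (use pos in auto)
  also have "\<dots> = real (hits E 0 (N * M))" 
    by (simp only: mult.commute[of N M] hits_mult[of E 0 M N] of_nat_sum)
  also have "\<dots> \<le> 1 / (2 * real N) * real (N * M)" by (rule hits_mult_le[OF M(2)])
  also have "\<dots> = real M / 2" using N by simp
  finally show False using M(1) by simp
qed

text \<open>The complement is syndetic, so a greedy search meets it in either direction.\<close>

lemma sparse_unbounded_complement:
  fixes E :: "'i::discrete_linordered_semidom set"
  assumes "sparse E"
  shows "\<exists>N\<ge>1. \<forall>i. \<exists>j<N. i + of_nat j \<notin> E"
proof -
  from assms[unfolded sparse_def, rule_format, of "1/2"]
  obtain N where N: "N \<ge> 1" "\<And>i. real (hits E i N) \<le> 1/2 * real N" by auto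
  have "\<exists>j<N. i + of_nat j \<notin> E" for i
  proof (rule ccontr)
    assume "\<not> ?thesis"
    then have "{j. j < N \<and> i + of_nat j \<in> E} = {..<N}" by auto
    then have "hits E i N = N" by (simp add: hits_eq)
    then show False using N(1) N(2)[of i] by simp
  qed
  with N(1) show ?thesis by blast
qed

lemma sparse_banach_density:
  fixes E :: "'i::discrete_linordered_semidom set"
  assumes E: "sparse E"
  shows "has_banach_density E 0"
proof -
  define f where "f N i = real (hits E i N) / real N" for N i
  have f: "0 \<le> f N i" "f N i \<le> 1" for N i
    using hits_le[of E i N] by (auto simp: f_def divide_le_eq_1)
  have bdd: "bdd_above (range (f N))" "bdd_below (range (f N))" for N
    using f by (auto intro: bdd_aboveI[of _ 1] bdd_belowI[of _ 0])
  have sup: "0 \<le> (SUP i. f N i)" for N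
    using cSUP_upper2[OF bdd(1), of undefined 0] f by auto
  have inf: "0 \<le> (INF i. f N i)" for N by (rule cINF_greatest) (auto simp: f)
  have inf0: "(INF i. f N i) \<le> 0" if N: "N \<in> {1..}" for N
  proof -
    obtain i where "hits E i N = 0" using sparse_gap[OF E, of N] N by auto
    then show ?thesis by (intro cINF_lower2[OF bdd(2), of i]) (auto simp: f_def)
  qed
  have "upper_banach_density E = (INF N\<in>{1..}. SUP i. f N i)"
    by (simp add: upper_banach_density_def f_def hits_def)
  also have "\<dots> = 0"
  proof (rule antisym)
    show "0 \<le> (INF N\<in>{1..}. SUP i. f N i)" by (rule cINF_greatest) (auto simp: sup)
    show "(INF N\<in>{1..}. SUP i. f N i) \<le> 0"
    proof (rule field_le_epsilon)
      fix \<delta> :: real assume "0 < \<delta>"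
      from E[unfolded sparse_def, rule_format, OF this]
      obtain N where N: "N \<ge> 1" "\<And>i. real (hits E i N) \<le> \<delta> * real N" by auto
      have "(SUP i. f N i) \<le> 0 + \<delta>"
        using N by (intro cSUP_least) (auto simp: f_def divide_le_eq)
      then show "(INF N\<in>{1..}. SUP i. f N i) \<le> 0 + \<delta>"
        using N(1) sup by (intro cINF_lower2[of _ _ N]) (auto intro: bdd_belowI[of _ 0])
    qed
  qed
  finally have upper: "upper_banach_density E = 0" .
  have "lower_banach_density E = (SUP N\<in>{1..}. INF i. f N i)"
    by (simp add: lower_banach_density_def f_def hits_def)
  also have "\<dots> = 0"
  proof (rule antisym)
    show "(SUP N\<in>{1..}. INF i. f N i) \<le> 0" by (rule cSUP_least) (auto simp: inf0)
    show "0 \<le> (SUP N\<in>{1..}. INF i. f N i)"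
      using inf0 inf by (intro cSUP_upper2[of _ _ 1]) (auto intro: bdd_aboveI[of _ 0])
  qed
  finally show ?thesis using upper by (simp add: has_banach_density_def)
qed

section \<open>Coordinates without good blocks\<close>

context windowed_subshift
begin

lemma extreme_weight_good_blocks:
  assumes U: "dstar_open X U" "Inr ` ergodic_measures X \<subseteq> U" and ext: "extreme_weight (lang X) p"
  obtains \<epsilon> F where "0 < \<epsilon>" "finite F"
    "\<And>B. B \<in> blocks X \<Longrightarrow> (\<And>C. C \<in> F \<Longrightarrow> \<bar>freq B C - p C\<bar> < \<epsilon>) \<Longrightarrow> Inl B \<in> U"
proof -
  have p: "invariant_weight (lang X) p" "p [] = 1" using ext by (auto simp: extreme_weight_def)
  from ergodic_measure_exists[OF ext] obtain \<nu>
    where \<nu>: "\<nu> \<in> ergodic_measures X" "\<And>C. val (Inr \<nu>) C = p C" by blast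
  then have "Inr \<nu> \<in> U" using U(2) by auto
  then obtain e where e: "0 < e" "\<And>q. q \<in> blocks_and_measures X \<Longrightarrow> dstar (Inr \<nu>) q < e \<Longrightarrow> q \<in> U"
    using U(1) by (auto simp: dstar_open_def)
  have "\<And>n. (\<Sum>C\<in>words n. p C) = 1" by (simp add: invariant_weight_total[OF p(1)] p(2))
  from dstar_series_small[OF invariant_weightD(1)[OF p(1)] this e(1)]
  obtain \<epsilon> F where F: "0 < \<epsilon>" "finite F" "\<And>B. (\<And>C. C \<in> F \<Longrightarrow> \<bar>freq B C - p C\<bar> < \<epsilon>) \<Longrightarrow>
     (\<Sum>l. (1/2) ^ Suc l * (\<Sum>C | length C = Suc l. \<bar>p C - freq B C\<bar>)) < e" by blast
  show ?thesis
  proof (rule that[OF F(1,2)])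
    fix B assume "B \<in> blocks X" and B: "\<And>C. C \<in> F \<Longrightarrow> \<bar>freq B C - p C\<bar> < \<epsilon>"
    have "dstar (Inr \<nu>) (Inl B) < e"
      unfolding dstar_def \<nu>(2) val.simps(1) by (rule F(3)[OF B])
    with \<open>B \<in> blocks X\<close> show "Inl B \<in> U"
      by (intro e(2)) (auto simp: blocks_and_measures_def)
  qed
qed

lemma not_dense_bad_words:
  fixes \<delta> :: real and B :: "nat \<Rightarrow> 'a list"
  assumes U: "dstar_open X U" "Inr ` ergodic_measures X \<subseteq> U"
    and H: "hereditary H" "\<And>B. B \<in> H \<Longrightarrow> m \<le> length B \<Longrightarrow> Inl B \<notin> U"
    and \<delta>: "0 < \<delta>" and B: "\<And>N. B N \<in> lang X" "\<And>N. length (B N) = N"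
    and dense: "\<And>N n. 1 \<le> N \<Longrightarrow> \<delta> * N - n \<le> card {i. i + n \<le> N \<and> take n (drop i (B N)) \<in> H}"
  shows False
proof -
  from hereditary_sparse[OF factor_closed_lang H(1) B dense]
  obtain p where p: "extreme_weight (lang X) p" "\<And>n. \<delta> \<le> mass H p n" by blast
  from extreme_weight_good_blocks[OF U p(1)] obtain \<epsilon> F where F: "0 < \<epsilon>" "finite F"
    "\<And>B. B \<in> blocks X \<Longrightarrow> (\<And>C. C \<in> F \<Longrightarrow> \<bar>freq B C - p C\<bar> < \<epsilon>) \<Longrightarrow> Inl B \<in> U" by blast
  \<comment> \<open>Length at least \<open>m\<close> contradicts the choice of \<open>H\<close>;
    length at least 1 makes the word an element of \<open>blocks X\<close>.\<close>
  from heavy_hereditary_typical[OF factor_closed_lang p(1) \<delta> p(2) F(1,2), of "max m 1"]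
  obtain A where A: "A \<in> H" "A \<in> lang X" "max m 1 \<le> length A" "\<And>C. C \<in> F \<Longrightarrow> \<bar>freq A C - p C\<bar> < \<epsilon>"
    by blast
  from A(2) obtain x i n where xin: "x \<in> X" "A = block x i n" by (auto simp: lang_def)
  then have "1 \<le> n" using A(3) by simp
  with xin have "A \<in> blocks X" unfolding blocks_def by blast
  then have "Inl A \<in> U" using F(3) A(4) by blast
  with H(2)[OF A(1)] A(3) show False by auto
qed

text \<open>At a bad start every prefix of length at least \<open>m\<close> of the word read there
  is outside \<open>U\<close>, so bad starts in an interval yield windows in the prefix-closed set
  \<open>H\<close>.\<close>

lemma sparse_bad_starts:
  assumes U: "dstar_open X U" "Inr ` ergodic_measures X \<subseteq> U" and x: "x \<in> X"
  shows "sparse {i. \<forall>n\<ge>m. Inl (block x i n) \<notin> U}" (is "sparse ?E")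
proof (rule ccontr)
  assume "\<not> ?thesis"
  then obtain \<delta> f where \<delta>: "0 < \<delta>" and f: "\<And>N. N \<ge> 1 \<Longrightarrow> \<delta> * real N < real (hits ?E (f N) N)"
    by (rule not_sparseE) blast
  define H where "H = {B :: 'a list. \<forall>V W. B = V @ W \<longrightarrow> m \<le> length V \<longrightarrow> Inl V \<notin> U}"
  have H: "hereditary H" unfolding hereditary_def H_def by auto
  show False
  proof (rule not_dense_bad_words[OF U H _ \<delta>(1), where B = "\<lambda>N. block x (f N) N" and m = m])
    show "Inl B \<notin> U" if "B \<in> H" "m \<le> length B" for B using that by (auto simp: H_def)
    show "block x (f N) N \<in> lang X" for N using x by (auto simp: lang_def)
    fix N n :: nat assume N: "1 \<le> N"
    define J where "J = {j. j < N \<and> f N + of_nat j \<in> ?E}"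
    define K where "K = {i. i + n \<le> N \<and> take n (drop i (block x (f N) N)) \<in> H}"
    have finK: "finite K" by (rule finite_subset[of _ "{..N}"]) (auto simp: K_def)
    have "j \<in> K" if "j \<in> J" "j + n \<le> N" for j
    proof -
      have "block x (f N + of_nat j) n \<in> H"
        unfolding H_def
      proof (intro CollectI allI impI)
        fix V W assume VW: "block x (f N + of_nat j) n = V @ W" and "m \<le> length V"
        have "length V \<le> n" using arg_cong[OF VW, of length] by simp
        then have "V = block x (f N + of_nat j) (length V)"
          using take_drop_block[of 0 "length V" n x "f N + of_nat j"] by (simp add: VW)
        with \<open>m \<le> length V\<close> that(1) show "Inl V \<notin> U" unfolding J_def by auto
      qed
      then show ?thesis using that(2) by (simp add: K_def take_drop_block)
    qed
    \<comment> \<open>The last \<open>n\<close> positions are given up, since a window of length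
      \<open>n\<close> may not fit there.\<close>
    then have "J \<subseteq> K \<union> {N - n..<N}" by (auto simp: J_def)
    then have "card J \<le> card (K \<union> {N - n..<N})" using finK by (intro card_mono) auto
    also have "\<dots> \<le> card K + n" using card_Un_le[of K "{N - n..<N}"] by simp
    finally have "real (card J) \<le> real (card K) + n" by linarith
    moreover have "\<delta> * real N < real (card J)" using f[OF N] by (simp add: hits_eq J_def)
    ultimately show "\<delta> * real N - real n \<le> card {i. i + n \<le> N \<and> take n (drop i (block x (f N) N)) \<in> H}"
      unfolding K_def by linarith
  qed simp
qed

end

text \<open>Mirror image of \<open>sparse_bad_starts\<close> with suffixes. The block of length
  \<open>n\<close> ending at \<open>i\<close> starts at \<open>i + 1 - n\<close>, hence the
  restriction to integer coordinates.\<close>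

lemma sparse_bad_ends:
  fixes X :: "(int \<Rightarrow> 'a::{finite, discrete_topology}) set"
  assumes "windowed_subshift X w wl"
    and U: "dstar_open X U" "Inr ` ergodic_measures X \<subseteq> U" and x: "x \<in> X"
  shows "sparse {i. \<forall>n\<ge>m. Inl (block x (i + 1 - int n) n) \<notin> U}" (is "sparse ?E")
proof (rule ccontr)
  interpret windowed_subshift X w wl by fact
  assume "\<not> ?thesis"
  then obtain \<delta> f where \<delta>: "0 < \<delta>" and f: "\<And>N. N \<ge> 1 \<Longrightarrow> \<delta> * real N < real (hits ?E (f N) N)"
    by (rule not_sparseE) blast
  define H where "H = {B :: 'a list. \<forall>V W. B = V @ W \<longrightarrow> m \<le> length W \<longrightarrow> Inl W \<notin> U}"
  have H: "hereditary H"
    unfolding hereditary_def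
  proof (intro disjI2 ballI allI impI)
    fix B V' W' assume "B \<in> H" "B = V' @ W'"
    then have "m \<le> length W \<longrightarrow> Inl W \<notin> U" if "W' = V @ W" for V W
      using that by (auto simp: H_def)
    then show "W' \<in> H" by (simp add: H_def)
  qed
  show False
  proof (rule not_dense_bad_words[OF U H _ \<delta>(1), where B = "\<lambda>N. block x (f N) N" and m = m])
    show "Inl B \<notin> U" if "B \<in> H" "m \<le> length B" for B using that by (auto simp: H_def)
    show "block x (f N) N \<in> lang X" for N using x by (auto simp: lang_def)
    fix N n :: nat assume N: "1 \<le> N"
    define J where "J = {j. j < N \<and> f N + int j \<in> ?E}"
    define K where "K = {i. i + n \<le> N \<and> take n (drop i (block x (f N) N)) \<in> H}"
    have finK: "finite K" by (rule finite_subset[of _ "{..N}"]) (auto simp: K_def)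
    have "j + 1 - n \<in> K" if "j \<in> J" "n \<le> j + 1" for j
    proof -
      have j: "int (j + 1 - n) = int j + 1 - int n" "j + 1 - n + n \<le> N" using that by (auto simp: J_def)
      have "block x (f N + int (j + 1 - n)) n \<in> H"
        unfolding H_def
      proof (intro CollectI allI impI)
        fix V W assume VW: "block x (f N + int (j + 1 - n)) n = V @ W" and "m \<le> length W"
        have n: "n = length V + length W" using arg_cong[OF VW, of length] by simp
        have "W = take (length W) (drop (length V) (block x (f N + int (j + 1 - n)) n))"
          unfolding VW by simp
        also have "\<dots> = block x (f N + int (j + 1 - n) + int (length V)) (length W)"
          by (rule take_drop_block) (simp add: n)
        also have "f N + int (j + 1 - n) + int (length V) = (f N + int j) + 1 - int (length W)"
          using j(1) n by linarith
        finally have W: "W = block x (f N + int j + 1 - int (length W)) (length W)" .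
        have "\<forall>n\<ge>m. Inl (block x (f N + int j + 1 - int n) n) \<notin> U"
          using that(1) by (simp add: J_def)
        with \<open>m \<le> length W\<close> show "Inl W \<notin> U" by (subst W) blast
      qed
      then show ?thesis using take_drop_block[OF j(2), of x "f N"] j(2) by (simp add: K_def)
    qed
    note inK = this
    \<comment> \<open>The map sends the start of a window to its last position; bad ends
      \<open>j < n\<close> are given up.\<close>
    have "J \<subseteq> (\<lambda>i. i + n - 1) ` K \<union> {..<n}"
    proof
      fix j assume j: "j \<in> J"
      show "j \<in> (\<lambda>i. i + n - 1) ` K \<union> {..<n}"
      proof (cases "j < n")
        case False
        then have "j = (j + 1 - n) + n - 1" "n \<le> j + 1" by auto
        then show ?thesis using inK[OF j] by blast
      qed simp
    qed
    then have "card J \<le> card ((\<lambda>i. i + n - 1) ` K \<union> {..<n})" using finK by (intro card_mono) auto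
    also have "\<dots> \<le> card ((\<lambda>i. i + n - 1) ` K) + n" using card_Un_le[of "(\<lambda>i. i + n - 1) ` K" "{..<n}"] by simp
    also have "\<dots> \<le> card K + n" using card_image_le[OF finK] by simp
    finally have "real (card J) \<le> real (card K) + n" by linarith
    moreover have "\<delta> * real N < real (card J)" using f[OF N] by (simp add: hits_eq J_def)
    ultimately show "\<delta> * real N - real n \<le> card {i. i + n \<le> N \<and> take n (drop i (block x (f N) N)) \<in> H}"
      unfolding K_def by linarith
  qed simp
qed

section \<open>Greedy decomposition\<close>

text \<open>From \<open>u k\<close>, an even step moves to the next point outside \<open>E\<close>,
  possibly not at all, and an odd step cuts a piece accepted by \<open>Q\<close>. Keeping
  \<open>Q\<close> abstract lets the lemma serve both directions.\<close>

lemma greedy_cuts: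
  fixes E :: "nat set" and Q :: "nat \<Rightarrow> nat \<Rightarrow> bool"
  assumes good: "\<And>t. t \<notin> E \<Longrightarrow> \<exists>n. Q t n" and pos: "\<And>t n. Q t n \<Longrightarrow> 1 \<le> n"
    and unb: "\<And>t. \<exists>t'\<ge>t. t' \<notin> E"
  obtains u :: "nat \<Rightarrow> nat" where "u 0 = 0" "\<And>k. u k \<le> u (Suc k)"
    "\<And>k. even k \<Longrightarrow> {u k..<u (Suc k)} \<subseteq> E" "\<And>k. odd k \<Longrightarrow> Q (u k) (u (Suc k) - u k)"
    "\<And>t. \<exists>k. u k \<le> t \<and> t < u (Suc k)"
proof -
  define nxt where "nxt t = (LEAST t'. t \<le> t' \<and> t' \<notin> E)" for t
  have nxt: "t \<le> nxt t" "nxt t \<notin> E" for t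
    using LeastI_ex[OF unb[of t]] by (auto simp: nxt_def)
  have nxt_E: "{t..<nxt t} \<subseteq> E" for t
  proof
    fix s assume "s \<in> {t..<nxt t}"
    then show "s \<in> E" using not_less_Least[of s "\<lambda>t'. t \<le> t' \<and> t' \<notin> E"] by (auto simp: nxt_def)
  qed
  define bl where "bl t = (SOME n. Q t n)" for t
  have bl: "Q t (bl t)" if "t \<notin> E" for t unfolding bl_def by (rule someI_ex[OF good[OF that]])
  define u where "u = rec_nat 0 (\<lambda>k t. if even k then nxt t else t + bl t)"
  have u0: "u 0 = 0" and u_even: "even k \<Longrightarrow> u (Suc k) = nxt (u k)"
    and u_odd: "odd k \<Longrightarrow> u (Suc k) = u k + bl (u k)" for k
    by (simp_all add: u_def)
  have odd_E: "u k \<notin> E" if "odd k" for k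
    using that by (cases k) (auto simp: u_even nxt)
  have mono: "u k \<le> u (Suc k)" for k
    by (cases "even k") (auto simp: u_even u_odd nxt)
  have Q: "Q (u k) (u (Suc k) - u k)" if "odd k" for k
    using bl[OF odd_E[OF that]] that by (simp add: u_odd)
  \<comment> \<open>Every odd step advances by at least 1, so the cuts exhaust all
    coordinates.\<close>
  have large: "k \<le> u (2 * k)" for k
  proof (induction k)
    case (Suc k)
    have "1 \<le> u (Suc (Suc (2 * k))) - u (Suc (2 * k))" by (rule pos[OF Q]) simp
    then have "u (Suc (2 * k)) + 1 \<le> u (Suc (Suc (2 * k)))" by linarith
    then show ?case using Suc mono[of "2 * k"] by simp
  qed simp
  have "\<exists>k. u k \<le> t \<and> t < u (Suc k)" for t
  proof -
    have ex: "\<exists>k. t < u k" using large[of "Suc t"] by (intro exI[of _ "2 * Suc t"]) simp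
    define k where "k = (LEAST k. t < u k)"
    have k: "t < u k" unfolding k_def by (rule LeastI_ex[OF ex])
    then obtain l where l: "k = Suc l" using u0 by (cases k) auto
    then have "\<not> t < u l" using not_less_Least[of l "\<lambda>k. t < u k"] by (simp add: k_def)
    with k l show ?thesis by (metis not_le)
  qed
  moreover have "{u k..<u (Suc k)} \<subseteq> E" if "even k" for k using nxt_E[of "u k"] that by (simp add: u_even)
  ultimately show ?thesis using that[of u] u0 mono Q by blast
qed

section \<open>One-sided and two-sided subshifts, and their decompositions\<close>

lemma one_sided_windowed:
  fixes X :: "(nat \<Rightarrow> 'a::{finite, discrete_topology}) set"
  assumes "one_sided_subshift X"
  shows "windowed_subshift X (\<lambda>_. 0) (\<lambda>k. k)"
proof
  show "closed X" using assms by (simp add: one_sided_subshift_def)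
  show sh: "shift x \<in> X" if "x \<in> X" for x using assms that by (auto simp: one_sided_subshift_def)
  fix i n k :: nat
  show "\<exists>y\<in>X. \<forall>j. y (0 + of_nat j) = x (i + of_nat j)" if "x \<in> X" for x
  proof (induction i)
    case 0
    then show ?case using that by (intro bexI[of _ x]) auto
  next
    case (Suc i)
    then obtain y where "y \<in> X" "\<forall>j. y (0 + of_nat j) = x (i + of_nat j)" by blast
    then show ?case using sh[of y] by (intro bexI[of _ "shift y"]) (auto simp: shift_def)
  qed
  show "\<forall>\<^sub>F k in sequentially. \<exists>a. i = 0 + of_nat a \<and> a + n \<le> k"
    using eventually_ge_at_top[of "i + n"] by eventually_elim auto
qed

lemma two_sided_windowed:
  fixes X :: "(int \<Rightarrow> 'a::{finite, discrete_topology}) set"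
  assumes "two_sided_subshift X"
  shows "windowed_subshift X (\<lambda>k. - int k) (\<lambda>k. 2 * k)"
proof
  have X: "shift ` X = X" using assms by (simp add: two_sided_subshift_def)
  show "closed X" using assms by (simp add: two_sided_subshift_def)
  show sh: "shift x \<in> X" if "x \<in> X" for x using X that by auto
  fix i :: int and n k :: nat
  have translate: "(\<lambda>j. x (j + c)) \<in> X" if "x \<in> X" for x and c :: int
  proof (induction c rule: int_induct[where k = 0])
    case base
    then show ?case using that by simp
  next
    case (step1 c)
    then show ?case using sh[OF step1(2)] by (simp add: shift_def ac_simps)
  next
    case (step2 c)
    from step2(2) X obtain y where y: "y \<in> X" "(\<lambda>j. x (j + c)) = shift y" by auto
    have "y = (\<lambda>j. x (j + (c - 1)))"
    proof
      fix j show "y j = x (j + (c - 1))"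
        using fun_cong[OF y(2), of "j - 1"] by (simp add: shift_def algebra_simps)
    qed
    with y(1) show ?case by simp
  qed
  show "\<exists>y\<in>X. \<forall>j. y (- int k + of_nat j) = x (i + of_nat j)" if "x \<in> X" for x
    using translate[OF that, of "i + int k"] by (rule rev_bexI) (simp add: algebra_simps)
  show "\<forall>\<^sub>F k in sequentially. \<exists>a. i = - int k + of_nat a \<and> a + n \<le> 2 * k"
    using eventually_ge_at_top[of "nat \<bar>i\<bar> + n"]
  proof eventually_elim
    case (elim k)
    then show ?case by (intro exI[of _ "nat (i + int k)"]) auto
  qed
qed

lemma one_sided_decomposition:
  fixes X :: "(nat \<Rightarrow> 'a::{finite, discrete_topology}) set"
  assumes X: "one_sided_subshift X" and U: "dstar_open X U" "Inr ` ergodic_measures X \<subseteq> U"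
    and m: "m \<ge> 1" and x: "x \<in> X"
  shows "\<exists>s len. consecutive_partition s len \<and>
         (\<forall>n\<in>B_cells. Inl (block x (s n) (len n)) \<in> U \<and> len n \<ge> m) \<and>
         has_banach_density (\<Union>n\<in>A_cells. cell s len n) 0"
proof -
  interpret windowed_subshift X "\<lambda>_. 0" "\<lambda>k. k" by (rule one_sided_windowed[OF X])
  define E where "E = {i. \<forall>n\<ge>m. Inl (block x i n) \<notin> U}"
  have E: "sparse E" unfolding E_def by (rule sparse_bad_starts[OF U x])
  obtain N where N: "\<And>i. \<exists>j<N. i + j \<notin> E" using sparse_unbounded_complement[OF E] by auto
  obtain u where u: "u 0 = 0" "\<And>k. u k \<le> u (Suc k)" "\<And>k. even k \<Longrightarrow> {u k..<u (Suc k)} \<subseteq> E"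
    "\<And>k. odd k \<Longrightarrow> m \<le> u (Suc k) - u k \<and> Inl (block x (u k) (u (Suc k) - u k)) \<in> U"
    "\<And>t. \<exists>k. u k \<le> t \<and> t < u (Suc k)"
  proof (rule greedy_cuts[of E "\<lambda>t n. m \<le> n \<and> Inl (block x t n) \<in> U"])
    show "\<exists>t'\<ge>t. t' \<notin> E" for t using N[of t] le_add1 by blast
  qed (use m in \<open>auto simp: E_def\<close>)
  define len where "len k = u (Suc k) - u k" for k
  have cell: "cell u len k = {u k..<u (Suc k)}" for k using u(2)[of k] by (simp add: cell_def len_def)
  have "\<exists>k. t \<in> cell u len k" for t using u(5)[of t] by (simp add: cell)
  then have "consecutive_partition u len"
    unfolding consecutive_partition_def using u(2) by (auto simp: len_def)
  moreover have "\<forall>n\<in>B_cells. Inl (block x (u n) (len n)) \<in> U \<and> len n \<ge> m"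
    using u(4) by (auto simp: B_cells_def A_cells_def len_def)
  moreover have "has_banach_density (\<Union>n\<in>A_cells. cell u len n) 0"
    by (intro sparse_banach_density sparse_subset[OF E]) (use u(3) in \<open>auto simp: cell A_cells_def\<close>)
  ultimately show ?thesis by blast
qed

lemma two_sided_decomposition:
  fixes X :: "(int \<Rightarrow> 'a::{finite, discrete_topology}) set"
  assumes X: "two_sided_subshift X" and U: "dstar_open X U" "Inr ` ergodic_measures X \<subseteq> U"
    and m: "m \<ge> 1" and x: "x \<in> X"
  shows "\<exists>s len. consecutive_partition s len \<and>
         (\<forall>n\<in>B_cells. Inl (block x (s n) (len n)) \<in> U \<and> len n \<ge> m) \<and>
         has_banach_density (\<Union>n\<in>A_cells. cell s len n) 0"
proof -
  note W = two_sided_windowed[OF X]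
  interpret windowed_subshift X "\<lambda>k. - int k" "\<lambda>k. 2 * k" by (rule W)
  define E where "E = {i. \<forall>n\<ge>m. Inl (block x i n) \<notin> U}"
  define E' where "E' = {i. \<forall>n\<ge>m. Inl (block x (i + 1 - int n) n) \<notin> U}"
  have E: "sparse E" unfolding E_def by (rule sparse_bad_starts[OF U x])
  have E': "sparse E'" unfolding E'_def by (rule sparse_bad_ends[OF W U x])
  obtain N where N: "\<And>i. \<exists>j<N. i + int j \<notin> E" using sparse_unbounded_complement[OF E] by auto
  obtain N' where N': "\<And>i. \<exists>j<N'. i + int j \<notin> E'" using sparse_unbounded_complement[OF E'] by auto
  obtain u where u: "u 0 = 0" "\<And>k. u k \<le> u (Suc k)" "\<And>k. even k \<Longrightarrow> {u k..<u (Suc k)} \<subseteq> {t. int t \<in> E}"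
    "\<And>k. odd k \<Longrightarrow> m \<le> u (Suc k) - u k \<and> Inl (block x (int (u k)) (u (Suc k) - u k)) \<in> U"
    "\<And>t. \<exists>k. u k \<le> t \<and> t < u (Suc k)"
  proof (rule greedy_cuts[of "{t. int t \<in> E}" "\<lambda>t n. m \<le> n \<and> Inl (block x (int t) n) \<in> U"])
    show "\<exists>t'\<ge>t. t' \<notin> {t. int t \<in> E}" for t
    proof -
      obtain j where "int t + int j \<notin> E" using N[of "int t"] by blast
      then show ?thesis by (intro exI[of _ "t + j"]) simp
    qed
  qed (use m in \<open>auto simp: E_def\<close>)
  \<comment> \<open>The left half is reflected by \<open>t\<close> to \<open>- t - 1\<close>: a
    piece of length \<open>n\<close> at \<open>t\<close> becomes the block from
    \<open>- t - n\<close> up to the coordinate \<open>- t - 1\<close>.\<close>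
  obtain v where v: "v 0 = 0" "\<And>k. v k \<le> v (Suc k)"
    "\<And>k. even k \<Longrightarrow> {v k..<v (Suc k)} \<subseteq> {t. - int t - 1 \<in> E'}"
    "\<And>k. odd k \<Longrightarrow> m \<le> v (Suc k) - v k \<and>
        Inl (block x (- int (v k) - int (v (Suc k) - v k)) (v (Suc k) - v k)) \<in> U"
    "\<And>t. \<exists>k. v k \<le> t \<and> t < v (Suc k)"
  proof (rule greedy_cuts[of "{t. - int t - 1 \<in> E'}"
        "\<lambda>t n. m \<le> n \<and> Inl (block x (- int t - int n) n) \<in> U"])
    show "\<exists>t'\<ge>t. t' \<notin> {t. - int t - 1 \<in> E'}" for t
    proof -
      \<comment> \<open>The \<open>N'\<close> coordinates just left of \<open>- t\<close> contain
        one outside \<open>E'\<close>; its reflection is at least \<open>t\<close>.\<close>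
      obtain j where j: "j < N'" "- int t - int N' + int j \<notin> E'" using N'[of "- int t - int N'"] by blast
      have "- int (t + N' - j - 1) - 1 = - int t - int N' + int j" using j(1) by auto
      then have "t + N' - j - 1 \<notin> {t. - int t - 1 \<in> E'}" using j(2) by (simp only: mem_Collect_eq not_False_eq_True)
      moreover have "t \<le> t + N' - j - 1" using j(1) by simp
      ultimately show ?thesis by blast
    qed
  qed (use m in \<open>auto simp: E'_def\<close>)
  \<comment> \<open>Piece \<open>k\<close> on the right becomes cell \<open>k\<close>, piece
    \<open>k\<close> on the left cell \<open>- k - 1\<close>; both halves meet at 0. For even
    \<open>k\<close> the index \<open>- k - 1\<close> is odd and negative, so even pieces are
    \<open>A_cells\<close> on both sides.\<close>
  define s where "s i = (if i \<ge> 0 then int (u (nat i)) else - int (v (nat (- i))))" for i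
  define len where "len i = nat (s (i + 1) - s i)" for i
  have s_pos: "s (int k) = int (u k)" "s (int k + 1) = int (u (Suc k))" for k
    by (simp_all add: s_def nat_add_distrib)
  have s_neg: "s (- int k) = - int (v k)" for k
    using u(1) v(1) by (cases "k = 0") (simp_all add: s_def)
  have s_neg': "s (- int k - 1) = - int (v (Suc k))" for k
  proof -
    have "- int k - 1 = - int (Suc k)" by simp
    then show ?thesis by (simp only: s_neg)
  qed
  have cases_i: "(\<exists>k. i = int k) \<or> (\<exists>k. i = - int k - 1)" for i :: int
  proof (cases "i \<ge> 0")
    case False
    then have "i = - int (nat (- i - 1)) - 1" by simp
    then show ?thesis by blast
  qed (metis zero_le_imp_eq_int)
  have step: "s i \<le> s (i + 1)" for i
    using cases_i[of i] u(2) v(2) by (auto simp: s_pos s_neg s_neg')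
  have len_pos: "len (int k) = u (Suc k) - u k" for k
    using u(2)[of k] by (simp add: len_def s_pos)
  have len_neg: "len (- int k - 1) = v (Suc k) - v k" for k
    using v(2)[of k] by (simp add: len_def s_neg s_neg')
  have cell: "cell s len i = {s i..<s (i + 1)}" for i using step[of i] by (simp add: cell_def len_def)
  have "\<exists>i. t \<in> cell s len i" for t
  proof (cases "t \<ge> 0")
    case True
    obtain k where "u k \<le> nat t" "nat t < u (Suc k)" using u(5) by blast
    then have "int (u k) \<le> t" "t < int (u (Suc k))" using True by linarith+
    then have "t \<in> cell s len (int k)" by (simp add: cell s_pos)
    then show ?thesis by blast
  next
    case False
    obtain k where "v k \<le> nat (- t - 1)" "nat (- t - 1) < v (Suc k)" using v(5) by blast
    then have "- int (v (Suc k)) \<le> t" "t < - int (v k)" using False by linarith+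
    then have "t \<in> cell s len (- int k - 1)" by (simp add: cell s_neg s_neg')
    then show ?thesis by blast
  qed
  then have "consecutive_partition s len"
    unfolding consecutive_partition_def using step by (auto simp: len_def)
  moreover have "Inl (block x (s i) (len i)) \<in> U \<and> len i \<ge> m" if "i \<in> B_cells" for i
    using cases_i[of i]
  proof (elim disjE exE)
    fix k assume i: "i = int k"
    then have "odd k" using that by (simp add: B_cells_def A_cells_def)
    then show ?thesis using u(4)[of k] by (simp add: i s_pos len_pos)
  next
    fix k assume i: "i = - int k - 1"
    then have "odd k" using that by (simp add: B_cells_def A_cells_def)
    moreover have "- int (v k) - int (v (Suc k) - v k) = - int (v (Suc k))" using v(2)[of k] by simp
    ultimately show ?thesis using v(4)[of k] by (simp add: i s_neg' len_neg)
  qed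
  moreover have "cell s len i \<subseteq> E \<union> E'" if "i \<in> A_cells" for i
    using cases_i[of i]
  proof (elim disjE exE)
    fix k assume i: "i = int k"
    then have "even k" using that by (simp add: A_cells_def)
    show ?thesis
    proof
      fix t assume "t \<in> cell s len i"
      then have t: "int (u k) \<le> t" "t < int (u (Suc k))" by (simp_all add: i cell s_pos)
      then have "nat t \<in> {u k..<u (Suc k)}" "0 \<le> t" by auto
      then show "t \<in> E \<union> E'" using u(3)[OF \<open>even k\<close>] by auto
    qed
  next
    fix k assume i: "i = - int k - 1"
    then have "even k" using that by (simp add: A_cells_def)
    show ?thesis
    proof
      fix t assume "t \<in> cell s len i"
      then have t: "- int (v (Suc k)) \<le> t" "t < - int (v k)" by (simp_all add: i cell s_neg s_neg')
      then have "nat (- t - 1) \<in> {v k..<v (Suc k)}" "t < 0" by auto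
      then have "- int (nat (- t - 1)) - 1 \<in> E'" using v(3)[OF \<open>even k\<close>] by blast
      with \<open>t < 0\<close> show "t \<in> E \<union> E'" by simp
    qed
  qed
  then have "has_banach_density (\<Union>n\<in>A_cells. cell s len n) 0"
    by (intro sparse_banach_density sparse_subset[OF sparse_Un[OF E E']]) blast
  ultimately show ?thesis by blast
qed

theorem theorem2p7:
  "(\<forall>(X :: (int \<Rightarrow> 'a::{finite, discrete_topology}) set) U (m::nat).
      two_sided_subshift X \<and> dstar_open X U \<and> Inr ` ergodic_measures X \<subseteq> U \<and> m \<ge> 1 \<longrightarrow>
      (\<forall>x\<in>X. \<exists>s len. consecutive_partition s len \<and>
         (\<forall>n\<in>B_cells. Inl (block x (s n) (len n)) \<in> U \<and> len n \<ge> m) \<and>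
         has_banach_density (\<Union>n\<in>A_cells. cell s len n) 0))
   \<and>
   (\<forall>(X :: (nat \<Rightarrow> 'a) set) U (m::nat).
      one_sided_subshift X \<and> dstar_open X U \<and> Inr ` ergodic_measures X \<subseteq> U \<and> m \<ge> 1 \<longrightarrow>
      (\<forall>x\<in>X. \<exists>s len. consecutive_partition s len \<and>
         (\<forall>n\<in>B_cells. Inl (block x (s n) (len n)) \<in> U \<and> len n \<ge> m) \<and>
         has_banach_density (\<Union>n\<in>A_cells. cell s len n) 0))"
  by (intro conjI allI impI ballI; elim conjE; rule two_sided_decomposition one_sided_decomposition)

end
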